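(* There exists an absolute constant $\gamma_0>0$ such that for every constant $\epsilon\in(0,1)$ the following holds. Let $m,d$ be growing parameters with $d>m(1-\gamma_0)$ (and $m-d\to\infty$), and let $K=(1-\epsilon)\binom{m}{\le m-d-1}$ (rounded to an integer). If $Z\subseteq\mathbb{F}_2^m$ is a uniformly random set of $K$ coordinates, then with probability $1-o(1)$ the code $\operatorname{RM}(m,d)$ can recover from erasure of the coordinates in $Z$; that is, no two distinct codewords of $\operatorname{RM}(m,d)$ agree on all coordinates of $\mathbb{F}_2^m\setminus Z$ (equivalently, no nonzero codeword is supported inside $Z$).
   Context: $\binom{m}{\le s}=\sum_{j=0}^{s}\binom{m}{j}$. The Reed–Muller code $\operatorname{RM}(m,d)\subseteq\mathbb{F}_2^{2^m}$ is the set of evaluation vectors, over all points of $\mathbb{F}_2^m$, of multilinear polynomials in $\mathbb{F}_2[x_1,\ldots,x_m]$ of degree at most $d$; coordinates are indexed by $\mathbb{F}_2^m$. *)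

theory Defs
  imports Complex_Main
begin

text \<open>Points of F_2^m are encoded by their supports: a point is a subset x of {..<m}
  (x_i = 1 iff i \<in> x). A multilinear monomial is a subset S of {..<m}
  (the product of x_i for i \<in> S); a multilinear polynomial over F_2 is a
  finite set P of monomials (those with coefficient 1). Its value at the point x
  is the parity of the number of monomials S \<in> P with S \<subseteq> x.
  A word of length 2^m is a function from points to bool (F_2), extended by False
  outside the point set.\<close>

definition points :: "nat \<Rightarrow> nat set set" where
  "points m = Pow {..<m}"

definition eval_poly :: "nat \<Rightarrow> nat set set \<Rightarrow> nat set \<Rightarrow> bool" where
  "eval_poly m P x = (x \<in> points m \<and> odd (card {S \<in> P. S \<subseteq> x}))"

definition RM :: "nat \<Rightarrow> nat \<Rightarrow> (nat set \<Rightarrow> bool) set" where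
  "RM m d = {eval_poly m P | P. P \<subseteq> {S. S \<subseteq> {..<m} \<and> card S \<le> d}}"

definition binom_le :: "nat \<Rightarrow> nat \<Rightarrow> nat" where
  "binom_le m s = (\<Sum>j\<le>s. m choose j)"

definition recovers_erasure :: "nat \<Rightarrow> nat \<Rightarrow> nat set set \<Rightarrow> bool" where
  "recovers_erasure m d Z =
     (\<forall>c1\<in>RM m d. \<forall>c2\<in>RM m d. (\<forall>x\<in>points m - Z. c1 x = c2 x) \<longrightarrow> c1 = c2)"

definition recovery_prob :: "nat \<Rightarrow> nat \<Rightarrow> nat \<Rightarrow> real" where
  "recovery_prob m d K =
     real (card {Z. Z \<subseteq> points m \<and> card Z = K \<and> recovers_erasure m d Z})
     / real (card {Z. Z \<subseteq> points m \<and> card Z = K})"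

end

theory Submission
  imports Defs "HOL-Combinatorics.Permutations" "HOL-Real_Asymp.Real_Asymp"
begin

text \<open>Put r = m - d - 1 and let R be the dimension of RM(m,r). The number of
  polynomials of degree at most r vanishing on Z is always at least 2^(R-K), and by duality at
  least twice that if Z is not correctable. So the failure probability is at most
  2^(K-R) times the sum over all f in RM(m,r) of (1 - wt f)^K, minus 1, where wt f is the
  fraction of points at which f is 1. It remains to bound the number of polynomials of each weight.

  If wt f lies below 2^(-k) with some margin, then f has weight below 2^(-k) on almost all flats spanned by t
  random directions. There f is determined by its restriction modulo polynomials of degree less
  than k, because the minimum distance of RM(t,k-1) is 2^(t-k+1). After a random affine change
  of coordinates, f is therefore determined by its monomials with at least k variables among the
  first t, together with a small set of errors in an interpolation set of size R. For low weights a
  large k makes the number of such monomials at most 2^t (r/m)^k R, which is tiny. For weights near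
  1/2 take k = 1 and use that these monomials make up at most a fraction 1 - (1 - 2r/m)^t of all.\<close>

section \<open>Reed-Muller polynomials and a 2-transitive automorphism group\<close>

text \<open>A polynomial of weight x contributes 2^(K-R) (1-x)^K, and except at the smallest weights
  only K <= R is used. Weight about 2^(-s) then saves an exponent of about 2^(-s) R, so the count at
  that weight must have an exponent that is a small fraction of 2^(-s) R. This forces k, and with it
  t, to grow with s. The slack R - K >= \<epsilon> R enters only at weights so small that (1-x)^K
  saves too little. For weight (1-b)/2 the factor 2^K (1-x)^K is (1+b)^K. Here a count 2^(R - C b R)
  with a suitable C is enough, and for b = 2^(-l) the case k = 1 saves about (9/10)^l R, which is
  much more. Once b is about 1/R^2 nothing has to be counted: all 2^R polynomials together
  contribute about 1, which is the 1 subtracted in the first-moment bound. The threshold r/m <=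
  2^(-40) is generous. It makes 2^t (r/m)^k negligible for t = 3s+2, k = s-1, s >= 8 and for t = 24,
  k = 1; it gives 1 - 2r/m >= 99/100; and it keeps R below 2^(m/40), so that the block of t
  variables near weight 1/2 fits into m.\<close>

definition pval :: "nat set set \<Rightarrow> nat set \<Rightarrow> bool" where
  "pval P x = odd (card {S \<in> P. S \<subseteq> x})"

text \<open>Monomials and points are both sets of indices, so this set is also the Hamming ball of
  radius r around the origin. In that role it is the interpolation set.\<close>

definition mons :: "nat \<Rightarrow> nat \<Rightarrow> nat set set" where
  "mons m r = {S. S \<subseteq> {..<m} \<and> card S \<le> r}"

lemma finite_points [simp]: "finite (points m)"
  by (simp add: points_def)

lemma card_points: "card (points m) = 2 ^ m"
  by (simp add: points_def card_Pow)

lemma finite_mons [simp]: "finite (mons m r)"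
  by (rule finite_subset[of _ "Pow {..<m}"]) (auto simp: mons_def)

lemma card_mons: "card (mons m r) = binom_le m r"
proof -
  have "mons m r = (\<Union>j\<in>{..r}. {S. S \<subseteq> {..<m} \<and> card S = j})"
    by (auto simp: mons_def)
  also have "card \<dots> = (\<Sum>j\<in>{..r}. card {S. S \<subseteq> {..<m} \<and> card S = j})"
    by (rule card_UN_disjoint) auto
  also have "\<dots> = binom_le m r"
    using n_subsets[of "{..<m}"] by (simp add: binom_le_def)
  finally show ?thesis .
qed

lemma odd_card_sym_diff:
  assumes "finite A" "finite B"
  shows "odd (card (sym_diff A B)) \<longleftrightarrow> odd (card A) \<noteq> odd (card B)"
proof -
  have "card A = card (A - B) + card (A \<inter> B)"
    by (metis assms(1) card_Diff_subset_Int card_mono finite_Int inf_le1 le_add_diff_inverse2)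
  moreover have "card B = card (B - A) + card (A \<inter> B)"
    by (metis assms(2) card_Diff_subset_Int card_mono finite_Int inf_commute inf_le2 le_add_diff_inverse2)
  moreover have "card (sym_diff A B) = card (A - B) + card (B - A)"
    using assms by (intro card_Un_disjoint) auto
  ultimately show ?thesis by auto
qed

lemma pval_sym_diff:
  assumes "finite P" "finite Q"
  shows "pval (sym_diff P Q) x \<longleftrightarrow> pval P x \<noteq> pval Q x"
proof -
  have "{S \<in> sym_diff P Q. S \<subseteq> x} = sym_diff {S \<in> P. S \<subseteq> x} {S \<in> Q. S \<subseteq> x}"
    by blast
  then show ?thesis
    unfolding pval_def by (simp only:) (intro odd_card_sym_diff; use assms in simp)
qed

lemma pval_empty [simp]: "\<not> pval {} x"
  by (simp add: pval_def)

lemma pval_insert: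
  assumes "finite P" "S \<notin> P"
  shows "pval (insert S P) x \<longleftrightarrow> pval P x \<noteq> (S \<subseteq> x)"
proof -
  have "{T \<in> insert S P. T \<subseteq> x} = (if S \<subseteq> x then insert S {T \<in> P. T \<subseteq> x} else {T \<in> P. T \<subseteq> x})"
    by auto
  then show ?thesis using assms by (auto simp: pval_def)
qed

text \<open>The evaluation matrix on the ball is triangular: a smallest monomial S of P, read as a
  point, contains no other monomial of P, so P takes the value 1 there.\<close>

lemma mons_vanish_imp_empty:
  assumes "P \<subseteq> mons m r" "\<And>x. x \<in> mons m r \<Longrightarrow> \<not> pval P x"
  shows "P = {}"
proof (rule ccontr)
  assume "P \<noteq> {}"
  moreover have fin: "finite P" using assms(1) finite_mons finite_subset by blast
  ultimately obtain S where S: "S \<in> P" "\<And>T. T \<in> P \<Longrightarrow> card S \<le> card T"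
    using arg_min_if_finite(1)[of P card] arg_min_least[of P _ card] by blast
  have "finite S" using S(1) assms(1) by (auto simp: mons_def intro: finite_subset)
  then have "T = S" if "T \<in> P" "T \<subseteq> S" for T
    using S(2)[OF that(1)] that(2) by (simp add: card_seteq)
  then have "{T \<in> P. T \<subseteq> S} = {S}" using S(1) by blast
  then have "pval P S" by (simp add: pval_def)
  then show False using assms S by blast
qed

lemma pval_inj_on_mons:
  assumes "P \<subseteq> mons m r" "Q \<subseteq> mons m r" "\<And>x. x \<in> mons m r \<Longrightarrow> pval P x = pval Q x"
  shows "P = Q"
proof -
  have fin: "finite P" "finite Q" using assms finite_mons finite_subset by blast+
  have "sym_diff P Q = {}"
  proof (rule mons_vanish_imp_empty)
    show "sym_diff P Q \<subseteq> mons m r" using assms(1,2) by blast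
    show "\<not> pval (sym_diff P Q) x" if "x \<in> mons m r" for x
      using assms(3)[OF that] pval_sym_diff[OF fin] by (simp only:)
  qed
  then show ?thesis by blast
qed

text \<open>Only values on \<open>points m\<close> matter, so products and substitutions can be
  handled as functions without writing down their coefficients.\<close>

definition deg_le :: "nat \<Rightarrow> nat \<Rightarrow> (nat set \<Rightarrow> bool) set" where
  "deg_le m r = {f. \<exists>Q\<subseteq>mons m r. \<forall>x\<in>points m. pval Q x = f x}"

lemma deg_le_cong:
  "f \<in> deg_le m r \<Longrightarrow> (\<And>x. x \<in> points m \<Longrightarrow> f x = g x) \<Longrightarrow> g \<in> deg_le m r"
  unfolding deg_le_def by auto

lemma deg_le_pval: "P \<subseteq> mons m r \<Longrightarrow> pval P \<in> deg_le m r"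
  by (auto simp: deg_le_def)

lemma deg_le_False: "(\<lambda>x. False) \<in> deg_le m r"
  unfolding deg_le_def by (rule CollectI, rule exI[of _ "{}"]) simp

lemma deg_le_mono: "f \<in> deg_le m r \<Longrightarrow> r \<le> s \<Longrightarrow> f \<in> deg_le m s"
proof -
  assume "f \<in> deg_le m r" "r \<le> s"
  moreover from this have "mons m r \<subseteq> mons m s" by (auto simp: mons_def)
  ultimately show ?thesis unfolding deg_le_def by blast
qed

lemma deg_le_xor:
  assumes "f \<in> deg_le m r" "g \<in> deg_le m r"
  shows "(\<lambda>x. f x \<noteq> g x) \<in> deg_le m r"
proof -
  obtain P Q where PQ: "P \<subseteq> mons m r" "Q \<subseteq> mons m r"
    "\<forall>x\<in>points m. pval P x = f x" "\<forall>x\<in>points m. pval Q x = g x"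
    using assms by (auto simp: deg_le_def)
  have "finite P" "finite Q" using PQ finite_mons finite_subset by blast+
  then have "\<forall>x\<in>points m. pval (sym_diff P Q) x = (f x \<noteq> g x)"
    using PQ(3,4) pval_sym_diff[of P Q] by metis
  moreover have "sym_diff P Q \<subseteq> mons m r" using PQ by blast
  ultimately show ?thesis unfolding deg_le_def by (intro CollectI exI conjI)
qed

lemma deg_le_monomial:
  assumes "S \<in> mons m r"
  shows "(\<lambda>x. S \<subseteq> x) \<in> deg_le m r"
proof -
  have "\<forall>x. pval {S} x = (S \<subseteq> x)" by (simp add: pval_insert)
  then show ?thesis using assms unfolding deg_le_def by (intro CollectI exI[of _ "{S}"]) simp
qed

text \<open>Reduces a degree bound to single monomials. \<open>g\<close> is a substitution and
  \<open>c\<close> an extra factor, so the lemma serves both multiplication by a coordinate and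
  composition with an affine map.\<close>

lemma deg_le_sum_monomials:
  assumes "finite P" "\<And>S. S \<in> P \<Longrightarrow> h S \<in> deg_le m r"
    and "\<And>S x. S \<in> P \<Longrightarrow> x \<in> points m \<Longrightarrow> h S x = (S \<subseteq> g x \<and> c x)"
  shows "(\<lambda>x. pval P (g x) \<and> c x) \<in> deg_le m r"
  using assms
proof (induction P)
  case empty
  then show ?case by (simp add: deg_le_False)
next
  case (insert S P)
  have "(\<lambda>x. (pval P (g x) \<and> c x) \<noteq> h S x) \<in> deg_le m r"
    using insert by (intro deg_le_xor) auto
  then show ?case
    by (rule deg_le_cong) (use insert in \<open>auto simp: pval_insert\<close>)
qed

lemma deg_le_mult_coord:
  assumes "f \<in> deg_le m r" "i < m"
  shows "(\<lambda>x. f x \<and> i \<in> x) \<in> deg_le m (Suc r)"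
proof -
  obtain P where P: "P \<subseteq> mons m r" "\<forall>x\<in>points m. pval P x = f x"
    using assms by (auto simp: deg_le_def)
  have "(\<lambda>x. pval P x \<and> i \<in> x) \<in> deg_le m (Suc r)"
  proof (rule deg_le_sum_monomials[where h = "\<lambda>S x. insert i S \<subseteq> x"])
    show "finite P" using P finite_mons finite_subset by blast
    show "(\<lambda>x. insert i S \<subseteq> x) \<in> deg_le m (Suc r)" if "S \<in> P" for S
    proof (rule deg_le_monomial)
      have "card (insert i S) \<le> Suc (card S)" by (simp add: card_insert_le_m1 card_insert_if card.infinite) 
      then show "insert i S \<in> mons m (Suc r)" using that P assms(2) by (auto simp: mons_def)
    qed
  qed auto
  then show ?thesis by (rule deg_le_cong) (use P in auto)
qed

lemma deg_le_mult_linear: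
  assumes "f \<in> deg_le m r" "u \<subseteq> {..<m}"
  shows "(\<lambda>x. f x \<and> odd (card (x \<inter> u))) \<in> deg_le m (Suc r)"
proof -
  have "finite u" using assms(2) finite_subset by blast
  then show ?thesis using assms(2)
  proof (induction u)
    case empty
    then show ?case by (simp add: deg_le_False)
  next
    case (insert i u)
    have "(\<lambda>x. (f x \<and> odd (card (x \<inter> u))) \<noteq> (f x \<and> i \<in> x)) \<in> deg_le m (Suc r)"
      using insert assms(1) by (intro deg_le_xor deg_le_mult_coord) auto
    then show ?case
    proof (rule deg_le_cong)
      fix x assume "x \<in> points m"
      have "x \<inter> insert i u = (if i \<in> x then insert i (x \<inter> u) else x \<inter> u)" by auto
      then show "((f x \<and> odd (card (x \<inter> u))) \<noteq> (f x \<and> i \<in> x)) = (f x \<and> odd (card (x \<inter> insert i u)))"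
        using insert by auto
    qed
  qed
qed

text \<open>The affine map x + (e + <x,u>) w over F_2. For \<open>u = {}\<close> and
  \<open>e = True\<close> it is the translation by w.\<close>

definition transvect :: "nat set \<Rightarrow> bool \<Rightarrow> nat set \<Rightarrow> nat set \<Rightarrow> nat set" where
  "transvect w e u x = (if e \<noteq> odd (card (x \<inter> u)) then sym_diff x w else x)"

lemma transvect_points:
  assumes "x \<in> points m" "w \<subseteq> {..<m}"
  shows "transvect w e u x \<in> points m"
proof -
  have "sym_diff x w \<subseteq> {..<m}" "x \<subseteq> {..<m}" using assms unfolding points_def by blast+
  then show ?thesis unfolding transvect_def points_def Pow_iff
    by (split if_split) (intro conjI impI)
qed

text \<open>Each coordinate of the image is an affine function of x, so a monomial S becomes a
  product of \<open>card S\<close> affine functions. The induction multiplies them one at a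
  time.\<close>

lemma deg_le_comp_transvect:
  assumes "f \<in> deg_le m r" "w \<subseteq> {..<m}" "u \<subseteq> {..<m}"
  shows "(\<lambda>x. f (transvect w e u x)) \<in> deg_le m r"
proof -
  note tp = transvect_points[OF _ assms(2), of _ e u]
  have mono: "(\<lambda>x. S \<subseteq> transvect w e u x) \<in> deg_le m (card S)" if "S \<subseteq> {..<m}" for S
  proof -
    have "finite S" using that finite_subset by blast
    then show ?thesis using that
    proof (induction S)
      case empty
      have "{} \<in> mons m (card {})" by (simp add: mons_def)
      then have "(\<lambda>x::nat set. {} \<subseteq> x) \<in> deg_le m (card {})" by (rule deg_le_monomial)
      then show ?case by simp
    next
      case (insert i S)
      let ?g = "\<lambda>x. S \<subseteq> transvect w e u x"
      have g: "?g \<in> deg_le m (card S)" using insert by simp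
      have c: "card (insert i S) = Suc (card S)" using insert by simp
      have g': "?g \<in> deg_le m (Suc (card S))" by (rule deg_le_mono[OF g]) simp
      have 1: "(\<lambda>x. ?g x \<and> i \<in> x) \<in> deg_le m (Suc (card S))"
        using g insert by (intro deg_le_mult_coord) auto
      have 2: "(\<lambda>x. ?g x \<and> odd (card (x \<inter> u))) \<in> deg_le m (Suc (card S))"
        using g assms by (intro deg_le_mult_linear) auto
      have 3: "(\<lambda>x. ?g x \<and> e) \<in> deg_le m (Suc (card S))"
        using g' deg_le_False by (cases e) auto
      have 4: "(\<lambda>x. if i \<in> w then (?g x \<and> e) \<noteq> (?g x \<and> odd (card (x \<inter> u))) else False)
          \<in> deg_le m (Suc (card S))"
        using deg_le_xor[OF 3 2] deg_le_False by (cases "i \<in> w") auto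
      have mem: "i \<in> transvect w e u x \<longleftrightarrow> (i \<in> x) \<noteq> (i \<in> w \<and> e \<noteq> odd (card (x \<inter> u)))" for x
        unfolding transvect_def by (cases "e \<noteq> odd (card (x \<inter> u))") auto
      have "((?g x \<and> i \<in> x) \<noteq> (if i \<in> w then (?g x \<and> e) \<noteq> (?g x \<and> odd (card (x \<inter> u))) else False))
          = (insert i S \<subseteq> transvect w e u x)" for x
        unfolding insert_subset mem by (cases "S \<subseteq> transvect w e u x"; cases "i \<in> w") auto
      then show ?case unfolding c
        by (intro deg_le_cong[OF deg_le_xor[OF 1 4]])
    qed
  qed
  obtain P where P: "P \<subseteq> mons m r" "\<forall>x\<in>points m. pval P x = f x"
    using assms by (auto simp: deg_le_def)
  have "(\<lambda>x. pval P (transvect w e u x) \<and> True) \<in> deg_le m r"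
  proof (rule deg_le_sum_monomials[where h = "\<lambda>S x. S \<subseteq> transvect w e u x"])
    show "finite P" using P finite_mons finite_subset by blast
    show "(\<lambda>x. S \<subseteq> transvect w e u x) \<in> deg_le m r" if "S \<in> P" for S
      using mono[of S] deg_le_mono that P by (auto simp: mons_def)
  qed auto
  then show ?thesis by (rule deg_le_cong) (use P tp in auto)
qed

text \<open>Instead of the affine group, all degree-preserving permutations are taken. The averaging
  rests on finiteness, closure under composition and 2-transitivity, for which transvections
  suffice.\<close>

definition rm_aut :: "nat \<Rightarrow> nat \<Rightarrow> (nat set \<Rightarrow> nat set) set" where
  "rm_aut m r = {\<sigma>. \<sigma> permutes points m \<and> (\<forall>f\<in>deg_le m r. f \<circ> \<sigma> \<in> deg_le m r)}"

lemma finite_rm_aut [simp]: "finite (rm_aut m r)"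
  by (rule finite_subset[OF _ finite_permutations[OF finite_points[of m]]]) (auto simp: rm_aut_def)

lemma id_in_rm_aut: "id \<in> rm_aut m r"
  by (simp add: rm_aut_def permutes_id)

lemma rm_aut_comp: "\<sigma> \<in> rm_aut m r \<Longrightarrow> \<tau> \<in> rm_aut m r \<Longrightarrow> \<sigma> \<circ> \<tau> \<in> rm_aut m r"
  by (auto simp: rm_aut_def permutes_compose comp_assoc[symmetric])

text \<open>If <w,u> = 0, adding w does not change <x,u>, so the map is its own inverse.\<close>

lemma transvect_in_rm_aut:
  assumes "w \<subseteq> {..<m}" "u \<subseteq> {..<m}" "even (card (w \<inter> u))"
  obtains \<tau> where "\<tau> \<in> rm_aut m r" "\<And>x. x \<in> points m \<Longrightarrow> \<tau> x = transvect w e u x"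
proof
  define \<tau> where "\<tau> x = (if x \<in> points m then transvect w e u x else x)" for x
  note tp = transvect_points[OF _ assms(1), of _ e u]
  have inv: "transvect w e u (transvect w e u x) = x" if "x \<in> points m" for x
  proof -
    have "finite (x \<inter> u)" "finite (w \<inter> u)"
      using that assms by (auto simp: points_def intro: finite_subset)
    moreover have "sym_diff x w \<inter> u = sym_diff (x \<inter> u) (w \<inter> u)" by blast
    ultimately have "odd (card (sym_diff x w \<inter> u)) = odd (card (x \<inter> u))"
      using odd_card_sym_diff[of "x \<inter> u" "w \<inter> u"] assms(3) by simp
    moreover have "sym_diff (sym_diff x w) w = x" by blast
    ultimately show ?thesis unfolding transvect_def by simp
  qed
  have "bij_betw \<tau> (points m) (points m)"
    by (rule bij_betw_byWitness[where f' = \<tau>]) (auto simp: \<tau>_def tp inv)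
  then have "\<tau> permutes points m" by (rule bij_imp_permutes) (simp add: \<tau>_def)
  moreover have "f \<circ> \<tau> \<in> deg_le m r" if "f \<in> deg_le m r" for f
    by (rule deg_le_cong[OF deg_le_comp_transvect[OF that assms(1,2), of e]]) (simp add: \<tau>_def)
  ultimately show "\<tau> \<in> rm_aut m r" by (simp add: rm_aut_def)
  show "\<tau> x = transvect w e u x" if "x \<in> points m" for x using that by (simp add: \<tau>_def)
qed

text \<open>A translation takes a to a' and b to some b1. A functional u equal to 1 on both b1 + a'
  and b' + a' needs at most two coordinates: a common one, or one from each. The transvection along
  w = b1 + b' with e = <a',u> then fixes a' and moves b1 to b'; moreover <w,u> = 1 + 1 = 0.\<close>

lemma rm_aut_2_transitive:
  assumes pts: "a \<in> points m" "b \<in> points m" "a' \<in> points m" "b' \<in> points m"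
    and ne: "a \<noteq> b" "a' \<noteq> b'"
  obtains \<tau> where "\<tau> \<in> rm_aut m r" "\<tau> a = a'" "\<tau> b = b'"
proof -
  obtain \<tau>1 where \<tau>1: "\<tau>1 \<in> rm_aut m r"
    "\<And>x. x \<in> points m \<Longrightarrow> \<tau>1 x = transvect (sym_diff a a') True {} x"
    by (rule transvect_in_rm_aut[of "sym_diff a a'" m "{}"]) (use pts in \<open>(simp add: points_def; blast)+\<close>)
  have fin: "finite x" if "x \<in> points m" for x
    using that by (auto simp: points_def intro: finite_subset)
  have \<tau>1_eq: "\<tau>1 x = sym_diff x (sym_diff a a')" if "x \<in> points m" for x
    using \<tau>1(2)[OF that] by (simp only: transvect_def Int_empty_right card.empty) simp
  have a1: "\<tau>1 a = a'" unfolding \<tau>1_eq[OF pts(1)] by blast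
  define b1 where "b1 = \<tau>1 b"
  have b1: "b1 = sym_diff b (sym_diff a a')"
    unfolding b1_def \<tau>1_eq[OF pts(2)] ..
  have b1p: "b1 \<in> points m" using pts unfolding b1 points_def by blast
  have b1ne: "sym_diff b1 a' \<noteq> {}" using ne(1) b1 by blast
  have b'ne: "sym_diff b' a' \<noteq> {}" using ne(2) by blast
  obtain u where u: "u \<subseteq> {..<m}" "odd (card (sym_diff b1 a' \<inter> u))" "odd (card (sym_diff b' a' \<inter> u))"
  proof (cases "sym_diff b1 a' \<inter> sym_diff b' a' = {}")
    case True
    obtain i j where ij: "i \<in> sym_diff b1 a'" "j \<in> sym_diff b' a'" using b1ne b'ne by blast
    have "sym_diff b1 a' \<inter> {i,j} = {i}" "sym_diff b' a' \<inter> {i,j} = {j}" using ij True by blast+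
    moreover have "{i,j} \<subseteq> {..<m}" using ij pts b1p unfolding points_def by blast
    ultimately show ?thesis using that[of "{i,j}"] by simp
  next
    case False
    then obtain i where i: "i \<in> sym_diff b1 a'" "i \<in> sym_diff b' a'" by blast
    have "sym_diff b1 a' \<inter> {i} = {i}" "sym_diff b' a' \<inter> {i} = {i}" using i by blast+
    moreover have "{i} \<subseteq> {..<m}" using i pts b1p unfolding points_def by blast
    ultimately show ?thesis using that[of "{i}"] by simp
  qed
  have sd: "sym_diff x y \<inter> u = sym_diff (x \<inter> u) (y \<inter> u)" for x y by blast
  have par: "odd (card (sym_diff x y \<inter> u)) = (odd (card (x \<inter> u)) \<noteq> odd (card (y \<inter> u)))"
    if "x \<in> points m" "y \<in> points m" for x y
    unfolding sd using fin that by (intro odd_card_sym_diff) auto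
  define w where "w = sym_diff b1 b'"
  have w: "w \<subseteq> {..<m}" using b1p pts unfolding w_def points_def by blast
  have "even (card (w \<inter> u))" unfolding w_def
    using par[OF b1p pts(4)] par[OF b1p pts(3)] par[OF pts(4) pts(3)] u by simp
  then obtain \<tau>2 where \<tau>2: "\<tau>2 \<in> rm_aut m r"
    "\<And>x. x \<in> points m \<Longrightarrow> \<tau>2 x = transvect w (odd (card (a' \<inter> u))) u x"
    using transvect_in_rm_aut[OF w u(1)] by metis
  have "\<tau>2 a' = a'" using \<tau>2(2)[OF pts(3)] by (simp add: transvect_def)
  moreover have "\<tau>2 b1 = b'" 
  proof -
    have "odd (card (b1 \<inter> u)) \<noteq> odd (card (a' \<inter> u))" using par[OF b1p pts(3)] u by simp
    then have "\<tau>2 b1 = sym_diff b1 w" using \<tau>2(2)[OF b1p] unfolding transvect_def by (simp only: if_True) simp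
    then show ?thesis unfolding w_def by blast
  qed
  ultimately show ?thesis
    using that[of "\<tau>2 \<circ> \<tau>1"] rm_aut_comp[OF \<tau>2(1) \<tau>1(1)] a1 b1_def by simp
qed

section \<open>Minimum distance and random flats\<close>

text \<open>Minimum distance of a Reed-Muller code on the subcube A, with the coordinates outside A
  frozen at c. Induction on A: if the derivative in direction a is nonzero, it has degree at most j
  - 1, and each of its ones yields a one of Q at exactly one of two neighbours. Otherwise Q does not
  depend on a and its weight doubles.\<close>

lemma pval_min_weight:
  assumes "finite A" "finite Q" "\<And>S. S \<in> Q \<Longrightarrow> card (S \<inter> A) \<le> j" "c \<inter> A = {}" "b0 \<subseteq> A" "pval Q (b0 \<union> c)"
  shows "2 ^ card A \<le> 2 ^ j * card {b. b \<subseteq> A \<and> pval Q (b \<union> c)}"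
  using assms
proof (induction A arbitrary: Q j c b0 rule: finite_induct)
  case empty
  then have "{b. b \<subseteq> {} \<and> pval Q (b \<union> c)} = {{}}" by auto
  then show ?case by simp
next
  case (insert a A)
  define F where "F b = pval Q (b \<union> c)" for b
  have fin: "finite {b. b \<subseteq> insert a A \<and> F b}" "finite {b. b \<subseteq> A \<and> F b}"
    using insert.hyps by (auto intro: finite_subset[of _ "Pow (insert a A)"])
  show ?case
  proof (cases "\<exists>b\<subseteq>A. F b \<noteq> F (insert a b)")
    case True
    then obtain b1 where b1: "b1 \<subseteq> A" "F b1 \<noteq> F (insert a b1)" by blast
    \<comment> \<open>Freezing a at 1 turns the monomials of Q that contain a into the derivative in
      direction a.\<close>
    define Q' where "Q' = {S \<in> Q. a \<in> S}"
    define c' where "c' = insert a c"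
    have Q': "pval Q' (b \<union> c') \<longleftrightarrow> F b \<noteq> F (insert a b)" if "b \<subseteq> A" for b
    proof -
      have a: "a \<notin> b \<union> c" using that insert.hyps insert.prems(3) by blast
      have "{S \<in> Q. S \<subseteq> insert a b \<union> c} = {S \<in> Q. S \<subseteq> b \<union> c} \<union> {S \<in> Q'. S \<subseteq> b \<union> c'}"
        using a by (auto simp: Q'_def c'_def)
      moreover have "{S \<in> Q. S \<subseteq> b \<union> c} \<inter> {S \<in> Q'. S \<subseteq> b \<union> c'} = {}"
        using a by (auto simp: Q'_def)
      ultimately have eq: "card {S \<in> Q. S \<subseteq> insert a b \<union> c} = card {S \<in> Q. S \<subseteq> b \<union> c} + card {S \<in> Q'. S \<subseteq> b \<union> c'}"
        using insert.prems(1) by (simp add: card_Un_disjoint Q'_def)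
      show ?thesis unfolding F_def pval_def eq odd_add by blast
    qed
    have deg: "Suc (card (S \<inter> A)) \<le> j" if "S \<in> Q'" for S
    proof -
      have "S \<inter> insert a A = insert a (S \<inter> A)" using that by (auto simp: Q'_def)
      then have "card (S \<inter> insert a A) = Suc (card (S \<inter> A))" using insert.hyps by simp
      then show ?thesis using insert.prems(2)[of S] that by (auto simp: Q'_def)
    qed
    have pv: "pval Q' (b1 \<union> c')" using Q'[OF b1(1)] b1(2) by blast
    then have "Q' \<noteq> {}" by auto
    then have j: "j \<noteq> 0" using deg by fastforce
    have "2 ^ card A \<le> 2 ^ (j - 1) * card {b. b \<subseteq> A \<and> pval Q' (b \<union> c')}"
    proof (rule insert.IH[OF _ _ _ b1(1) pv])
      show "finite Q'" using insert.prems(1) by (simp add: Q'_def)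
      show "c' \<inter> A = {}" using insert.prems(3) insert.hyps by (auto simp: c'_def)
      show "card (S \<inter> A) \<le> j - 1" if "S \<in> Q'" for S using deg[OF that] by simp
    qed
    also have "card {b. b \<subseteq> A \<and> pval Q' (b \<union> c')} \<le> card {b. b \<subseteq> insert a A \<and> F b}"
    proof (rule card_inj_on_le[where f = "\<lambda>b. if F b then b else insert a b"])
      show "inj_on (\<lambda>b. if F b then b else insert a b) {b. b \<subseteq> A \<and> pval Q' (b \<union> c')}"
      proof (rule inj_on_inverseI[where g = "\<lambda>b. b - {a}"])
        fix b assume "b \<in> {b. b \<subseteq> A \<and> pval Q' (b \<union> c')}"
        then have "a \<notin> b" using insert.hyps by blast
        then show "(if F b then b else insert a b) - {a} = b" by auto
      qed
      show "(\<lambda>b. if F b then b else insert a b) ` {b. b \<subseteq> A \<and> pval Q' (b \<union> c')} \<subseteq> {b. b \<subseteq> insert a A \<and> F b}"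
        using Q' by auto
    qed (rule fin(1))
    finally have "2 ^ card A \<le> 2 ^ (j - 1) * card {b. b \<subseteq> insert a A \<and> F b}" by simp
    moreover obtain i where "j = Suc i" using j not0_implies_Suc by blast
    ultimately show ?thesis using insert.hyps by (simp add: F_def)
  next
    case False
    have same: "F (insert a b) = F b" if "b \<subseteq> A" for b using False that by blast
    have "F (b0 - {a})"
    proof (cases "a \<in> b0")
      case True
      then have "insert a (b0 - {a}) = b0" by blast
      then show ?thesis using same[of "b0 - {a}"] insert.prems(4,5) by (auto simp: F_def)
    next
      case False
      then show ?thesis using insert.prems(5) by (simp add: F_def)
    qed
    then have "2 ^ card A \<le> 2 ^ j * card {b. b \<subseteq> A \<and> pval Q (b \<union> c)}"
    proof (intro insert.IH[OF insert.prems(1), of j c "b0 - {a}"])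
      show "card (S \<inter> A) \<le> j" if "S \<in> Q" for S
        using insert.prems(2)[OF that] insert.hyps
        by (meson Int_mono card_mono finite.insertI finite_Int le_trans subset_insertI subset_refl)
    qed (use insert.prems in \<open>auto simp: F_def\<close>)
    moreover have "2 * card {b. b \<subseteq> A \<and> F b} \<le> card {b. b \<subseteq> insert a A \<and> F b}"
    proof -
      have "inj_on (insert a) {b. b \<subseteq> A \<and> F b}"
        by (rule inj_on_inverseI[where g = "\<lambda>b. b - {a}"]) (use insert.hyps in auto)
      then have "card (insert a ` {b. b \<subseteq> A \<and> F b}) = card {b. b \<subseteq> A \<and> F b}"
        by (rule card_image)
      moreover have "card ({b. b \<subseteq> A \<and> F b} \<union> insert a ` {b. b \<subseteq> A \<and> F b})
          = card {b. b \<subseteq> A \<and> F b} + card (insert a ` {b. b \<subseteq> A \<and> F b})"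
        using fin(2) insert.hyps by (intro card_Un_disjoint) auto
      moreover have "card ({b. b \<subseteq> A \<and> F b} \<union> insert a ` {b. b \<subseteq> A \<and> F b}) \<le> card {b. b \<subseteq> insert a A \<and> F b}"
        using fin(1) same by (intro card_mono) auto
      ultimately show ?thesis by simp
    qed
    ultimately have "2 * 2 ^ card A \<le> 2 ^ j * card {b. b \<subseteq> insert a A \<and> F b}"
      unfolding F_def by (smt (verit) mult.left_commute mult_le_mono2 le_trans)
    then show ?thesis using insert.hyps by (simp add: F_def)
  qed
qed

text \<open>The subcube through x in the first t coordinate directions. The flat itself is
  deterministic; it becomes random by applying a random element of \<open>rm_aut\<close>.\<close>

definition flat :: "nat \<Rightarrow> nat set \<Rightarrow> nat set set" where
  "flat t x = (\<lambda>b. b \<union> (x - {..<t})) ` Pow {..<t}"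

lemma inj_on_flat: "inj_on (\<lambda>b. b \<union> (x - {..<t})) (Pow {..<t})"
  by (rule inj_on_inverseI[where g = "\<lambda>b. b \<inter> {..<t}"]) auto

lemma finite_flat [simp]: "finite (flat t x)"
  by (simp add: flat_def)

lemma card_flat: "card (flat t x) = 2 ^ t"
  unfolding flat_def by (subst card_image[OF inj_on_flat]) (simp add: card_Pow)

lemma flat_subset_points: "x \<in> points m \<Longrightarrow> t \<le> m \<Longrightarrow> flat t x \<subseteq> points m"
  by (force simp: flat_def points_def)

text \<open>The high monomials cancel in P + Q, so on the flat its degree is at most k - 1. Its
  weight there is below 2 * 2^(t-k), which is exactly the minimum distance for that degree, so P + Q
  vanishes on the flat and in particular at x.\<close>

lemma pval_eq_if_sparse_on_flat:
  assumes fin: "finite P" "finite Q" and "k \<ge> 1"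
    and high: "{S \<in> P. k \<le> card (S \<inter> {..<t})} = {S \<in> Q. k \<le> card (S \<inter> {..<t})}"
    and P: "2 ^ k * card {y \<in> flat t x. pval P y} < 2 ^ t"
    and Q: "2 ^ k * card {y \<in> flat t x. pval Q y} < 2 ^ t"
  shows "pval P x = pval Q x"
proof (rule ccontr)
  assume "pval P x \<noteq> pval Q x"
  then have D: "pval (sym_diff P Q) x" using pval_sym_diff[OF fin] by blast
  have x: "x = (x \<inter> {..<t}) \<union> (x - {..<t})" by blast
  have card_le: "card {b. b \<subseteq> {..<t} \<and> pval (sym_diff P Q) (b \<union> (x - {..<t}))}
      \<le> card {y \<in> flat t x. pval P y} + card {y \<in> flat t x. pval Q y}"
  proof -
    have "card {b. b \<subseteq> {..<t} \<and> pval (sym_diff P Q) (b \<union> (x - {..<t}))}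
        \<le> card ({y \<in> flat t x. pval P y} \<union> {y \<in> flat t x. pval Q y})"
    proof (rule card_inj_on_le[where f = "\<lambda>b. b \<union> (x - {..<t})"])
      show "inj_on (\<lambda>b. b \<union> (x - {..<t})) {b. b \<subseteq> {..<t} \<and> pval (sym_diff P Q) (b \<union> (x - {..<t}))}"
        by (rule inj_on_subset[OF inj_on_flat]) auto
      show "(\<lambda>b. b \<union> (x - {..<t})) ` {b. b \<subseteq> {..<t} \<and> pval (sym_diff P Q) (b \<union> (x - {..<t}))}
          \<subseteq> {y \<in> flat t x. pval P y} \<union> {y \<in> flat t x. pval Q y}"
        unfolding pval_sym_diff[OF fin] flat_def by blast
    qed simp
    also have "\<dots> \<le> card {y \<in> flat t x. pval P y} + card {y \<in> flat t x. pval Q y}"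
      by (rule card_Un_le)
    finally show ?thesis .
  qed
  have "2 ^ card {..<t} \<le> 2 ^ (k - 1) * card {b. b \<subseteq> {..<t} \<and> pval (sym_diff P Q) (b \<union> (x - {..<t}))}"
  proof (rule pval_min_weight[where ?b0.0 = "x \<inter> {..<t}"])
    show "pval (sym_diff P Q) (x \<inter> {..<t} \<union> (x - {..<t}))" using D x by simp
    show "card (S \<inter> {..<t}) \<le> k - 1" if "S \<in> sym_diff P Q" for S
    proof (rule ccontr)
      assume "\<not> card (S \<inter> {..<t}) \<le> k - 1"
      then have "k \<le> card (S \<inter> {..<t})" by simp
      then show False using that high by blast
    qed
  qed (use fin in auto)
  also have "\<dots> \<le> 2 ^ (k - 1) * (card {y \<in> flat t x. pval P y} + card {y \<in> flat t x. pval Q y})"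
    using card_le by simp
  finally have "2 * 2 ^ t \<le> (2 * 2 ^ (k - 1)) * (card {y \<in> flat t x. pval P y} + card {y \<in> flat t x. pval Q y})"
    by simp
  moreover have "2 * 2 ^ (k - 1) = (2::nat) ^ k" using \<open>k \<ge> 1\<close> by (cases k) auto
  ultimately show False using P Q by (simp add: distrib_left)
qed

section \<open>Images of one point and of two points under a random automorphism\<close>

lemma card_fiber_equidist:
  fixes h :: "'a \<Rightarrow> 'b"
  assumes "finite G" "finite D" "h ` G \<subseteq> D" "E \<subseteq> D"
    and le: "\<And>p q. p \<in> D \<Longrightarrow> q \<in> D \<Longrightarrow> card {\<sigma> \<in> G. h \<sigma> = p} \<le> card {\<sigma> \<in> G. h \<sigma> = q}"
  shows "card D * card {\<sigma> \<in> G. h \<sigma> \<in> E} = card E * card G"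
proof -
  have sum: "card {\<sigma> \<in> G. h \<sigma> \<in> B} = (\<Sum>p\<in>B. card {\<sigma> \<in> G. h \<sigma> = p})" if "B \<subseteq> D" for B
  proof -
    have "{\<sigma> \<in> G. h \<sigma> \<in> B} = (\<Union>p\<in>B. {\<sigma> \<in> G. h \<sigma> = p})" by auto
    also have "card \<dots> = (\<Sum>p\<in>B. card {\<sigma> \<in> G. h \<sigma> = p})"
      using that assms finite_subset by (intro card_UN_disjoint) auto
    finally show ?thesis .
  qed
  show ?thesis
  proof (cases "D = {}")
    case True
    then show ?thesis using assms by auto
  next
    case False
    then obtain q where q: "q \<in> D" by blast
    have eq: "card {\<sigma> \<in> G. h \<sigma> = p} = card {\<sigma> \<in> G. h \<sigma> = q}" if "p \<in> D" for p
      using le[OF that q] le[OF q that] by simp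
    have c: "card {\<sigma> \<in> G. h \<sigma> \<in> B} = card B * card {\<sigma> \<in> G. h \<sigma> = q}" if "B \<subseteq> D" for B
      using sum[OF that] eq that by (simp add: subset_iff)
    have "{\<sigma> \<in> G. h \<sigma> \<in> D} = G" using assms by auto
    then show ?thesis using c[OF assms(4)] c[of D] by simp
  qed
qed

text \<open>Composition with a fixed \<tau> on the left is injective on the group. This compares the
  number of automorphisms sending x to p with the number sending x to q whenever \<tau> moves p to
  q.\<close>

lemma card_rm_aut_le:
  assumes "\<tau> \<in> rm_aut m r" "\<And>\<sigma>. A \<sigma> \<Longrightarrow> B (\<tau> \<circ> \<sigma>)"
  shows "card {\<sigma> \<in> rm_aut m r. A \<sigma>} \<le> card {\<sigma> \<in> rm_aut m r. B \<sigma>}"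
proof (rule card_inj_on_le[where f = "\<lambda>\<sigma>. \<tau> \<circ> \<sigma>"])
  have "inj \<tau>" using assms(1) by (auto simp: rm_aut_def permutes_inj)
  then show "inj_on ((\<circ>) \<tau>) {\<sigma> \<in> rm_aut m r. A \<sigma>}"
    by (intro inj_onI) (simp add: fun_eq_iff inj_eq)
qed (use assms rm_aut_comp in auto)

lemma rm_aut_points: "\<sigma> \<in> rm_aut m r \<Longrightarrow> x \<in> points m \<Longrightarrow> \<sigma> x \<in> points m"
  by (simp add: rm_aut_def permutes_in_image)

lemma rm_aut_inj: "\<sigma> \<in> rm_aut m r \<Longrightarrow> \<sigma> x = \<sigma> y \<longleftrightarrow> x = y"
  by (metis (no_types, lifting) rm_aut_def mem_Collect_eq permutes_inj inj_eq)

lemma card_rm_aut_point: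
  assumes "F \<subseteq> points m" "x \<in> points m"
  shows "2 ^ m * card {\<sigma> \<in> rm_aut m r. \<sigma> x \<in> F} = card F * card (rm_aut m r)"
  unfolding card_points[symmetric]
proof (rule card_fiber_equidist[where h = "\<lambda>\<sigma>. \<sigma> x"])
  show "card {\<sigma> \<in> rm_aut m r. \<sigma> x = p} \<le> card {\<sigma> \<in> rm_aut m r. \<sigma> x = q}"
    if pq: "p \<in> points m" "q \<in> points m" for p q
  proof (cases "p = q")
    case False
    \<comment> \<open>Transitivity on points is read off from 2-transitivity by exchanging p and q,
      hence the case p = q is separate.\<close>
    obtain \<tau> where \<tau>: "\<tau> \<in> rm_aut m r" "\<tau> p = q" "\<tau> q = p"
      by (rule rm_aut_2_transitive[of p m q q p r]) (use pq False in auto)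
    show ?thesis by (rule card_rm_aut_le[OF \<tau>(1)]) (use \<tau> in auto)
  qed simp
qed (use assms rm_aut_points in auto)

text \<open>The image of (x, y) is uniform over ordered pairs of distinct points, so with w = |F|
  and n = 2^m the probability is w(w-1) / (n(n-1)). This is at most (w/n)^2 because w <= n.\<close>

lemma card_rm_aut_pair:
  assumes "F \<subseteq> points m" "x \<in> points m" "y \<in> points m" "x \<noteq> y"
  shows "(2 ^ m)\<^sup>2 * card {\<sigma> \<in> rm_aut m r. \<sigma> x \<in> F \<and> \<sigma> y \<in> F} \<le> (card F)\<^sup>2 * card (rm_aut m r)"
proof -
  define off where "off B = {(p, q). p \<in> B \<and> q \<in> B \<and> p \<noteq> q}" for B :: "nat set set"
  have card_off: "card (off B) = card B * (card B - 1)" if "finite B" for B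
  proof -
    have "off B = (SIGMA p:B. B - {p})" by (auto simp: off_def)
    then show ?thesis using that by simp
  qed
  have finF: "finite F" using assms(1) finite_subset finite_points by blast
  have "card (off (points m)) * card {\<sigma> \<in> rm_aut m r. (\<sigma> x, \<sigma> y) \<in> off F}
      = card (off F) * card (rm_aut m r)"
  proof (rule card_fiber_equidist[where h = "\<lambda>\<sigma>. (\<sigma> x, \<sigma> y)"])
    show "finite (off (points m))"
      by (rule finite_subset[of _ "points m \<times> points m"]) (auto simp: off_def)
    show "(\<lambda>\<sigma>. (\<sigma> x, \<sigma> y)) ` rm_aut m r \<subseteq> off (points m)"
      using assms rm_aut_points rm_aut_inj by (auto simp: off_def)
    show "off F \<subseteq> off (points m)" using assms by (auto simp: off_def)
    fix p q assume "p \<in> off (points m)" "q \<in> off (points m)"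
    then obtain a b a' b' where ab: "p = (a, b)" "q = (a', b')" "a \<in> points m" "b \<in> points m"
      "a' \<in> points m" "b' \<in> points m" "a \<noteq> b" "a' \<noteq> b'" by (auto simp: off_def)
    obtain \<tau> where \<tau>: "\<tau> \<in> rm_aut m r" "\<tau> a = a'" "\<tau> b = b'"
      by (rule rm_aut_2_transitive[of a m b a' b' r]) (use ab in auto)
    show "card {\<sigma> \<in> rm_aut m r. (\<sigma> x, \<sigma> y) = p} \<le> card {\<sigma> \<in> rm_aut m r. (\<sigma> x, \<sigma> y) = q}"
      by (rule card_rm_aut_le[OF \<tau>(1)]) (use \<tau> ab in auto)
  qed simp
  moreover have "{\<sigma> \<in> rm_aut m r. (\<sigma> x, \<sigma> y) \<in> off F} = {\<sigma> \<in> rm_aut m r. \<sigma> x \<in> F \<and> \<sigma> y \<in> F}"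
    using assms rm_aut_inj by (auto simp: off_def)
  ultimately have eq: "2 ^ m * (2 ^ m - 1) * card {\<sigma> \<in> rm_aut m r. \<sigma> x \<in> F \<and> \<sigma> y \<in> F}
      = card F * (card F - 1) * card (rm_aut m r)"
    using card_off[OF finite_points] card_off[OF finF] by (simp add: card_points)
  define c where "c = card {\<sigma> \<in> rm_aut m r. \<sigma> x \<in> F \<and> \<sigma> y \<in> F}"
  define n :: nat where "n = 2 ^ m"
  define w where "w = card F"
  define g where "g = card (rm_aut m r)"
  have w: "w \<le> n" unfolding w_def n_def card_points[symmetric] using assms(1) by (intro card_mono) auto
  have "card {x, y} \<le> n" unfolding n_def card_points[symmetric] using assms by (intro card_mono) auto
  then have n: "n \<ge> 2" using assms by simp
  have "(w - 1) * n \<le> (n - 1) * w" using w n by (simp add: algebra_simps diff_mult_distrib)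
  have "(n - 1) * (n\<^sup>2 * c) = n * (n * (n - 1) * c)" by (simp add: power2_eq_square)
  also have "\<dots> = w * g * ((w - 1) * n)" using eq by (simp add: c_def n_def w_def g_def ac_simps)
  also have "\<dots> \<le> w * g * ((n - 1) * w)" using \<open>(w - 1) * n \<le> (n - 1) * w\<close> by simp
  also have "\<dots> = (n - 1) * (w\<^sup>2 * g)" by (simp add: power2_eq_square)
  finally show ?thesis using n by (simp add: c_def n_def w_def g_def)
qed

text \<open>Chebyshev's inequality: 2-transitivity makes the points of a random image of a flat
  pairwise negatively correlated.\<close>

lemma card_rm_aut_dense_flat:
  fixes w :: real
  assumes "F \<subseteq> points m" "x \<in> points m" "t \<le> m"
    and w: "real (card F) \<le> w * 2 ^ m" "w < 1 / 2 ^ k"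
  shows "real (card {\<sigma> \<in> rm_aut m r. 2 ^ t \<le> 2 ^ k * card {y \<in> flat t x. \<sigma> y \<in> F}})
     * (2 ^ t * (1 / 2 ^ k - w)\<^sup>2) \<le> w * real (card (rm_aut m r))"
proof -
  define G where "G = rm_aut m r"
  define w0 where "w0 = real (card F) / 2 ^ m"
  define X where "X \<sigma> = real (card {y \<in> flat t x. \<sigma> y \<in> F})" for \<sigma>
  define n :: real where "n = 2 ^ t"
  have sub: "flat t x \<subseteq> points m" using assms flat_subset_points by blast
  have X: "X \<sigma> = (\<Sum>y\<in>flat t x. of_bool (\<sigma> y \<in> F))" for \<sigma>
    by (simp add: X_def Int_def)
  have finG: "finite G" by (simp add: G_def)
  have one: "(\<Sum>\<sigma>\<in>G. of_bool (\<sigma> y \<in> F)) = w0 * card G" if "y \<in> flat t x" for y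
  proof -
    have "real (2 ^ m * card {\<sigma> \<in> G. \<sigma> y \<in> F}) = real (card F * card G)"
      unfolding G_def using sub that by (intro arg_cong[of _ _ real] card_rm_aut_point[OF assms(1)]) blast
    then show ?thesis using finG by (simp add: w0_def field_simps Int_def)
  qed
  have two: "(\<Sum>\<sigma>\<in>G. of_bool (\<sigma> y \<in> F \<and> \<sigma> z \<in> F)) \<le> w0\<^sup>2 * card G"
    if "y \<in> flat t x" "z \<in> flat t x" "y \<noteq> z" for y z
  proof -
    have "real ((2 ^ m)\<^sup>2 * card {\<sigma> \<in> G. \<sigma> y \<in> F \<and> \<sigma> z \<in> F}) \<le> real ((card F)\<^sup>2 * card G)"
      unfolding G_def of_nat_le_iff using assms sub that by (intro card_rm_aut_pair) auto
    then show ?thesis using finG by (simp add: w0_def field_simps Int_def)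
  qed
  have S1: "(\<Sum>\<sigma>\<in>G. X \<sigma>) = n * w0 * card G"
    unfolding X by (subst sum.swap) (simp add: one card_flat n_def)
  have S2: "(\<Sum>\<sigma>\<in>G. (X \<sigma>)\<^sup>2) \<le> n * w0 * card G + n\<^sup>2 * w0\<^sup>2 * card G"
  proof -
    have "(\<Sum>\<sigma>\<in>G. (X \<sigma>)\<^sup>2) = (\<Sum>\<sigma>\<in>G. \<Sum>y\<in>flat t x. \<Sum>z\<in>flat t x. of_bool (\<sigma> y \<in> F \<and> \<sigma> z \<in> F))"
      unfolding X power2_eq_square by (simp only: sum_product of_bool_conj)
    also have "\<dots> = (\<Sum>y\<in>flat t x. \<Sum>z\<in>flat t x. \<Sum>\<sigma>\<in>G. of_bool (\<sigma> y \<in> F \<and> \<sigma> z \<in> F))"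
      by (subst sum.swap) (intro sum.cong refl sum.swap)
    \<comment> \<open>The diagonal contributes the mean; off the diagonal, negative correlation
      gives at most the square of the density. The variance of \<open>X\<close> is therefore at most
      n * w0.\<close>
    also have "\<dots> \<le> (\<Sum>y\<in>flat t x. \<Sum>z\<in>flat t x. (if z = y then w0 * card G else 0) + w0\<^sup>2 * card G)"
    proof (intro sum_mono)
      fix y z assume yz: "y \<in> flat t x" "z \<in> flat t x"
      show "(\<Sum>\<sigma>\<in>G. of_bool (\<sigma> y \<in> F \<and> \<sigma> z \<in> F)) \<le> (if z = y then w0 * card G else 0) + w0\<^sup>2 * card G"
      proof (cases "z = y")
        case True
        then show ?thesis using one[OF yz(1)] by simp
      qed (use two[OF yz] in auto)
    qed
    also have "\<dots> = n * w0 * card G + n\<^sup>2 * w0\<^sup>2 * card G"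
      by (simp add: sum.distrib card_flat n_def power2_eq_square algebra_simps)
    finally show ?thesis .
  qed
  have w0: "0 \<le> w0" "w0 \<le> w" using w(1) by (simp_all add: w0_def field_simps)
  have n: "n > 0" by (simp add: n_def)
  define B where "B = {\<sigma> \<in> G. 2 ^ t \<le> 2 ^ k * card {y \<in> flat t x. \<sigma> y \<in> F}}"
  \<comment> \<open>On \<open>B\<close> the count \<open>X\<close> exceeds its mean n * w0 by at
    least n (2^(-k) - w), since the true density \<open>w0\<close> is at most
    \<open>w\<close>.\<close>
  have "card B * (n * (1 / 2 ^ k - w))\<^sup>2 \<le> (\<Sum>\<sigma>\<in>B. (X \<sigma> - n * w0)\<^sup>2)"
  proof -
    have "(n * (1 / 2 ^ k - w))\<^sup>2 \<le> (X \<sigma> - n * w0)\<^sup>2" if "\<sigma> \<in> B" for \<sigma>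
    proof (rule power_mono)
      have "real (2 ^ t) \<le> real (2 ^ k * card {y \<in> flat t x. \<sigma> y \<in> F})"
        using that unfolding B_def of_nat_le_iff by blast
      then have "n / 2 ^ k \<le> X \<sigma>" by (simp add: n_def X_def field_simps)
      moreover have "n * w0 \<le> n * w" using w0 n by simp
      ultimately show "n * (1 / 2 ^ k - w) \<le> X \<sigma> - n * w0" by (simp add: right_diff_distrib)
      show "0 \<le> n * (1 / 2 ^ k - w)" using w n by simp
    qed
    then have "(\<Sum>\<sigma>\<in>B. (n * (1 / 2 ^ k - w))\<^sup>2) \<le> (\<Sum>\<sigma>\<in>B. (X \<sigma> - n * w0)\<^sup>2)" by (rule sum_mono)
    then show ?thesis by simp
  qed
  also have "\<dots> \<le> (\<Sum>\<sigma>\<in>G. (X \<sigma> - n * w0)\<^sup>2)"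
    using finG by (intro sum_mono2) (auto simp: B_def)
  also have "\<dots> = (\<Sum>\<sigma>\<in>G. (X \<sigma>)\<^sup>2) - 2 * (n * w0) * (\<Sum>\<sigma>\<in>G. X \<sigma>) + n\<^sup>2 * w0\<^sup>2 * card G"
  proof -
    have "(X \<sigma> - n * w0)\<^sup>2 = (X \<sigma>)\<^sup>2 - 2 * (n * w0) * X \<sigma> + n\<^sup>2 * w0\<^sup>2" for \<sigma>
      by (simp add: power2_eq_square algebra_simps)
    then show ?thesis
      by (simp only: sum.distrib sum_subtractf sum_distrib_left[symmetric]) simp
  qed
  also have "\<dots> \<le> n * w0 * card G"
    using S2 unfolding S1 by (simp add: power2_eq_square algebra_simps)
  also have "\<dots> \<le> n * (w * card G)" using w0 n by (simp add: mult_right_mono)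
  finally have "n * (card B * (n * (1 / 2 ^ k - w)\<^sup>2)) \<le> n * (w * card G)"
    by (simp add: power2_eq_square algebra_simps)
  then show ?thesis using n unfolding B_def G_def n_def by simp
qed

section \<open>Counting polynomials of low weight\<close>

definition weight :: "nat \<Rightarrow> nat set set \<Rightarrow> nat" where
  "weight m P = card {x \<in> points m. pval P x}"

lemma mons_subset_points: "mons m r \<subseteq> points m"
  by (auto simp: mons_def points_def)

text \<open>Averaging over the automorphisms replaces the error set of the decoder on a fixed
  interpolation set, namely the ball mons m r, by a set of the average size.\<close>

lemma card_low_weight:
  fixes w a :: real
  assumes "t \<le> m" "k \<ge> 1" "a > 0" "w \<ge> 0" "w < 1 / 2 ^ k" "w / (2 ^ t * (1 / 2 ^ k - w)\<^sup>2) \<le> a / 2"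
    and W: "W \<subseteq> Pow (mons m r)" "\<And>P. P \<in> W \<Longrightarrow> real (weight m P) \<le> w * 2 ^ m"
  shows "card W \<le> 2 * (2 ^ card {S \<in> mons m r. k \<le> card (S \<inter> {..<t})}
    * (card {E. E \<subseteq> mons m r \<and> real (card E) \<le> a * card (mons m r)})\<^sup>2)"
proof -
  define G where "G = rm_aut m r"
  define T where "T = mons m r"
  define H where "H = {S \<in> mons m r. k \<le> card (S \<inter> {..<t})}"
  define \<S> where "\<S> = {E. E \<subseteq> T \<and> real (card E) \<le> a * card T}"
  \<comment> \<open>At a \<open>bad\<close> point the moved flat carries at least a 2^(-k) fraction
    of ones, so uniqueness on that flat is not guaranteed.\<close>
  define bad where "bad \<sigma> P x \<longleftrightarrow> 2 ^ t \<le> 2 ^ k * card {y \<in> flat t x. pval P (\<sigma> y)}" for \<sigma> P x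
  define err where "err \<sigma> P = {x \<in> T. bad \<sigma> P x}" for \<sigma> P
  define ok where "ok \<sigma> P \<longleftrightarrow> real (card (err \<sigma> P)) \<le> a * card T" for \<sigma> P
  have finG: "finite G" and finT: "finite T" by (simp_all add: G_def T_def)
  have "{} \<in> mons m r" by (simp add: mons_def)
  then have T0: "card T > 0" using finT by (auto simp: T_def card_gt_0_iff)
  have G0: "card G > 0" using finG id_in_rm_aut by (auto simp: G_def card_gt_0_iff)
  have finW: "finite W" using W(1) by (rule finite_subset) simp
  have fin\<S>: "finite \<S>" by (rule finite_subset[of _ "Pow T"]) (auto simp: \<S>_def finT)

  \<comment> \<open>Markov's inequality: by Chebyshev each interpolation point is bad with
    probability at most a/2, so the expected error set has size at most (a/2) |T|, and at least half
    of the automorphisms are \<open>ok\<close>.\<close>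
  have half: "real (card G) \<le> 2 * real (card {\<sigma> \<in> G. ok \<sigma> P})" if "P \<in> W" for P
  proof -
    define F where "F = {x \<in> points m. pval P x}"
    have F: "F \<subseteq> points m" "real (card F) \<le> w * 2 ^ m"
      using W(2)[OF that] by (auto simp: F_def weight_def)
    have bad_le: "real (card {\<sigma> \<in> G. bad \<sigma> P x}) \<le> a / 2 * card G" if "x \<in> T" for x
    proof -
      have x: "x \<in> points m" using that mons_subset_points by (auto simp: T_def)
      have "{\<sigma> \<in> G. bad \<sigma> P x} = {\<sigma> \<in> G. 2 ^ t \<le> 2 ^ k * card {y \<in> flat t x. \<sigma> y \<in> F}}"
      proof (intro Collect_cong conj_cong refl)
        fix \<sigma> assume "\<sigma> \<in> G"
        then have "{y \<in> flat t x. pval P (\<sigma> y)} = {y \<in> flat t x. \<sigma> y \<in> F}"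
          using rm_aut_points flat_subset_points[OF x assms(1)] by (auto simp: F_def G_def)
        then show "bad \<sigma> P x \<longleftrightarrow> 2 ^ t \<le> 2 ^ k * card {y \<in> flat t x. \<sigma> y \<in> F}"
          unfolding bad_def by simp
      qed
      then have "real (card {\<sigma> \<in> G. bad \<sigma> P x}) * (2 ^ t * (1 / 2 ^ k - w)\<^sup>2) \<le> w * card G"
        using card_rm_aut_dense_flat[OF F(1) x assms(1) F(2) assms(5), of r] unfolding G_def by simp
      moreover have "2 ^ t * (1 / 2 ^ k - w)\<^sup>2 > 0" using assms(5) by simp
      ultimately have "real (card {\<sigma> \<in> G. bad \<sigma> P x}) \<le> w / (2 ^ t * (1 / 2 ^ k - w)\<^sup>2) * card G"
        by (simp add: field_simps)
      also have "\<dots> \<le> a / 2 * card G" using assms(6) by (intro mult_right_mono) auto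
      finally show ?thesis .
    qed
    have "a * card T * card {\<sigma> \<in> G. \<not> ok \<sigma> P} \<le> (\<Sum>\<sigma>\<in>{\<sigma> \<in> G. \<not> ok \<sigma> P}. real (card (err \<sigma> P)))"
      using sum_mono[of "{\<sigma> \<in> G. \<not> ok \<sigma> P}" "\<lambda>_. a * card T" "\<lambda>\<sigma>. real (card (err \<sigma> P))"]
      by (simp add: ok_def mult.commute)
    also have "\<dots> \<le> (\<Sum>\<sigma>\<in>G. real (card (err \<sigma> P)))" using finG by (intro sum_mono2) auto
    also have "\<dots> = (\<Sum>\<sigma>\<in>G. \<Sum>x\<in>T. of_bool (bad \<sigma> P x))" using finT by (simp add: err_def Int_def)
    also have "\<dots> = (\<Sum>x\<in>T. real (card {\<sigma> \<in> G. bad \<sigma> P x}))"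
      using finG by (subst sum.swap) (simp add: Int_def)
    also have "\<dots> \<le> (\<Sum>x\<in>T. a / 2 * card G)" using bad_le by (rule sum_mono)
    also have "\<dots> = a * card T * (card G / 2)" by simp
    finally have "real (card {\<sigma> \<in> G. \<not> ok \<sigma> P}) \<le> card G / 2"
      using T0 assms(3) by (simp add: mult_le_cancel_left_pos)
    moreover have "card {\<sigma> \<in> G. \<not> ok \<sigma> P} + card {\<sigma> \<in> G. ok \<sigma> P} = card G"
    proof -
      have "{\<sigma> \<in> G. \<not> ok \<sigma> P} \<union> {\<sigma> \<in> G. ok \<sigma> P} = G" by blast
      moreover have "card ({\<sigma> \<in> G. \<not> ok \<sigma> P} \<union> {\<sigma> \<in> G. ok \<sigma> P})
          = card {\<sigma> \<in> G. \<not> ok \<sigma> P} + card {\<sigma> \<in> G. ok \<sigma> P}"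
        using finG by (intro card_Un_disjoint) auto
      ultimately show ?thesis by simp
    qed
    then have "real (card {\<sigma> \<in> G. \<not> ok \<sigma> P}) + card {\<sigma> \<in> G. ok \<sigma> P} = card G"
      by (simp only: of_nat_add[symmetric])
    ultimately show ?thesis by simp
  qed

  have B: "card {P \<in> W. ok \<sigma> P} \<le> 2 ^ card H * (card \<S>)\<^sup>2" if \<sigma>: "\<sigma> \<in> G" for \<sigma>
  proof -
    have "\<forall>P\<in>Pow (mons m r). \<exists>Q. Q \<subseteq> mons m r \<and> (\<forall>y\<in>points m. pval Q y = pval P (\<sigma> y))"
    proof
      fix P assume "P \<in> Pow (mons m r)"
      then have "pval P \<circ> \<sigma> \<in> deg_le m r"
        using \<sigma> deg_le_pval by (auto simp: G_def rm_aut_def)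
      then show "\<exists>Q. Q \<subseteq> mons m r \<and> (\<forall>y\<in>points m. pval Q y = pval P (\<sigma> y))"
        unfolding deg_le_def by auto
    qed
    then obtain tr where tr: "\<And>P. P \<in> Pow (mons m r) \<Longrightarrow> tr P \<subseteq> mons m r"
      "\<And>P y. P \<in> Pow (mons m r) \<Longrightarrow> y \<in> points m \<Longrightarrow> pval (tr P) y = pval P (\<sigma> y)"
      by metis
    \<comment> \<open>The data from which P is recovered once \<sigma> is fixed: the high monomials
      of P after the change of coordinates, the error set, and the values on it. The last two are
      small subsets of T, whence the square of \<open>card \<S>\<close>.\<close>
    define \<Phi> where "\<Phi> P = ({S \<in> tr P. k \<le> card (S \<inter> {..<t})}, err \<sigma> P, {x \<in> err \<sigma> P. pval (tr P) x})" for P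
    have sparse: "2 ^ k * card {y \<in> flat t x. pval (tr P) y} < 2 ^ t"
      if "P \<in> W" "x \<in> T" "x \<notin> err \<sigma> P" for P x
    proof -
      have x: "x \<in> points m" using that mons_subset_points by (auto simp: T_def)
      have "{y \<in> flat t x. pval (tr P) y} = {y \<in> flat t x. pval P (\<sigma> y)}"
        using tr(2)[of P] W(1) that(1) flat_subset_points[OF x assms(1)] by auto
      then show ?thesis using that by (auto simp: err_def bad_def)
    qed
    have "inj_on \<Phi> {P \<in> W. ok \<sigma> P}"
    proof (rule inj_onI)
      fix P P' assume P: "P \<in> {P \<in> W. ok \<sigma> P}" "P' \<in> {P \<in> W. ok \<sigma> P}" and eq: "\<Phi> P = \<Phi> P'"
      have sub: "P \<in> Pow (mons m r)" "P' \<in> Pow (mons m r)" using P W(1) by auto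
      note fin = finite_subset[OF tr(1)[OF sub(1)] finite_mons] finite_subset[OF tr(1)[OF sub(2)] finite_mons]
      have high: "{S \<in> tr P. k \<le> card (S \<inter> {..<t})} = {S \<in> tr P'. k \<le> card (S \<inter> {..<t})}"
        and err: "err \<sigma> P = err \<sigma> P'"
        and on_err: "{x \<in> err \<sigma> P. pval (tr P) x} = {x \<in> err \<sigma> P'. pval (tr P') x}"
        using eq unfolding \<Phi>_def prod.inject by blast+
      have "tr P = tr P'"
      proof (rule pval_inj_on_mons[OF tr(1)[OF sub(1)] tr(1)[OF sub(2)]])
        fix x assume x: "x \<in> mons m r"
        show "pval (tr P) x = pval (tr P') x"
        proof (cases "x \<in> err \<sigma> P")
          case True
          then show ?thesis using on_err err by blast
        next
          case False
          then show ?thesis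
            using P x err by (intro pval_eq_if_sparse_on_flat[OF fin assms(2) high] sparse) (auto simp: T_def)
        qed
      qed
      then have eq\<sigma>: "pval P (\<sigma> y) = pval P' (\<sigma> y)" if "y \<in> points m" for y
        using tr(2) sub that by metis
      show "P = P'"
      proof (rule pval_inj_on_mons[of _ m r])
        fix x assume "x \<in> mons m r"
        then have "x \<in> \<sigma> ` points m"
          using \<sigma> mons_subset_points[of m r] by (auto simp: G_def rm_aut_def permutes_image)
        then show "pval P x = pval P' x" using eq\<sigma> by blast
      qed (use sub in auto)
    qed
    moreover have "\<Phi> ` {P \<in> W. ok \<sigma> P} \<subseteq> Pow H \<times> (\<S> \<times> \<S>)"
    proof
      fix z assume "z \<in> \<Phi> ` {P \<in> W. ok \<sigma> P}"
      then obtain P where P: "P \<in> W" "ok \<sigma> P" "z = \<Phi> P" by blast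
      have e: "err \<sigma> P \<in> \<S>" using P(2) by (auto simp: \<S>_def ok_def err_def)
      have "card {x \<in> err \<sigma> P. pval (tr P) x} \<le> card (err \<sigma> P)"
        using finT by (intro card_mono) (auto simp: err_def)
      then have "{x \<in> err \<sigma> P. pval (tr P) x} \<in> \<S>" using e by (auto simp: \<S>_def)
      moreover have "{S \<in> tr P. k \<le> card (S \<inter> {..<t})} \<in> Pow H"
        using tr(1)[of P] P(1) W(1) by (auto simp: H_def)
      ultimately show "z \<in> Pow H \<times> (\<S> \<times> \<S>)" using e P(3) by (simp add: \<Phi>_def)
    qed
    moreover have "finite H" by (simp add: H_def)
    ultimately have "card {P \<in> W. ok \<sigma> P} \<le> card (Pow H \<times> (\<S> \<times> \<S>))"
      using fin\<S> by (intro card_inj_on_le) auto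
    also have "\<dots> = 2 ^ card H * (card \<S>)\<^sup>2"
      using \<open>finite H\<close> by (simp add: card_cartesian_product card_Pow power2_eq_square)
    finally show ?thesis .
  qed

  \<comment> \<open>Double counting of the \<open>ok\<close> pairs (P, \<sigma>). The leading factor
    2 of the bound is the loss from \<open>half\<close>.\<close>
  have "real (card W) * card G = (\<Sum>P\<in>W. real (card G))" by simp
  also have "\<dots> \<le> (\<Sum>P\<in>W. 2 * real (card {\<sigma> \<in> G. ok \<sigma> P}))" using half by (rule sum_mono)
  also have "\<dots> = 2 * (\<Sum>P\<in>W. \<Sum>\<sigma>\<in>G. of_bool (ok \<sigma> P))"
    using finG by (simp add: sum_distrib_left Int_def)
  also have "\<dots> = 2 * (\<Sum>\<sigma>\<in>G. real (card {P \<in> W. ok \<sigma> P}))"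
    using finW by (subst sum.swap) (simp add: Int_def)
  also have "\<dots> \<le> 2 * (\<Sum>\<sigma>\<in>G. real (2 ^ card H * (card \<S>)\<^sup>2))"
    using B by (intro mult_left_mono sum_mono of_nat_mono) auto
  also have "\<dots> = real (2 * (2 ^ card H * (card \<S>)\<^sup>2)) * card G" by simp
  finally have "real (card W) \<le> real (2 * (2 ^ card H * (card \<S>)\<^sup>2))"
    using G0 by (simp only: mult_le_cancel_right of_nat_0_less_iff)
  then show ?thesis unfolding of_nat_le_iff H_def \<S>_def T_def .
qed

text \<open>Entropy bound by an exponential moment: give E the weight a^|E|. All subsets together
  weigh (1+a)^|T|, and each small one weighs at least a^(a|T|).\<close>

lemma card_small_subsets:
  fixes a :: real
  assumes "finite T" "0 < a" "a \<le> 1"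
  shows "real (card {E. E \<subseteq> T \<and> real (card E) \<le> a * card T}) \<le> exp (card T * (a + a * ln (1 / a)))"
proof -
  define \<S> where "\<S> = {E. E \<subseteq> T \<and> real (card E) \<le> a * card T}"
  have sub: "\<S> \<subseteq> Pow T" by (auto simp: \<S>_def)
  have "card \<S> * a powr (a * card T) = (\<Sum>E\<in>\<S>. a powr (a * card T))" by simp
  also have "\<dots> \<le> (\<Sum>E\<in>\<S>. a ^ card E)"
  proof (rule sum_mono)
    fix E assume "E \<in> \<S>"
    then have "a powr (a * card T) \<le> a powr (real (card E))"
      using assms by (intro powr_mono') (auto simp: \<S>_def)
    then show "a powr (a * card T) \<le> a ^ card E" using assms by (simp add: powr_realpow)
  qed
  also have "\<dots> \<le> (\<Sum>E\<in>Pow T. a ^ card E)"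
    using sub assms by (intro sum_mono2) auto
  also have "\<dots> = (\<Prod>x\<in>T. a + 1)"
    using assms(1) by (simp only: prod_add) simp
  also have "\<dots> \<le> exp a ^ card T"
    using assms exp_ge_add_one_self[of a] by (simp add: power_mono add.commute)
  also have "\<dots> = exp (card T * a)" by (simp add: exp_of_nat_mult)
  finally have "card \<S> * a powr (a * card T) \<le> exp (card T * a)" .
  moreover have "a powr (a * card T) = exp (- (card T * (a * ln (1 / a))))"
    using assms by (simp add: powr_def ln_div)
  ultimately show ?thesis
    unfolding \<S>_def[symmetric] by (simp add: exp_minus field_simps exp_add)
qed

section \<open>Duality and the first moment\<close>

lemma card_supersets:
  assumes "finite A" "U \<subseteq> A"
  shows "card {x. U \<subseteq> x \<and> x \<subseteq> A} = 2 ^ (card A - card U)"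
proof -
  have "{x. U \<subseteq> x \<and> x \<subseteq> A} = (\<lambda>y. y \<union> U) ` Pow (A - U)"
  proof (intro equalityI subsetI)
    fix x assume "x \<in> {x. U \<subseteq> x \<and> x \<subseteq> A}"
    then show "x \<in> (\<lambda>y. y \<union> U) ` Pow (A - U)" by (intro image_eqI[of _ _ "x - U"]) auto
  qed (use assms in auto)
  moreover have "inj_on (\<lambda>y. y \<union> U) (Pow (A - U))"
    by (rule inj_on_inverseI[where g = "\<lambda>y. y - U"]) auto
  ultimately show ?thesis
    using assms by (simp add: card_image card_Pow card_Diff_subset finite_subset)
qed

text \<open>The product of P and Q is a sum of monomials S \<union> T with fewer than m variables,
  and each of these is 1 on an even number of points.\<close>

lemma RM_dual:
  assumes P: "P \<subseteq> mons m d" and Q: "Q \<subseteq> mons m r" and dr: "d + r < m"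
  shows "even (card {x \<in> points m. pval P x \<and> pval Q x})"
proof -
  have fin: "finite P" "finite Q" using P Q finite_mons finite_subset by blast+
  define f where "f x = card {S \<in> P. S \<subseteq> x} * card {S \<in> Q. S \<subseteq> x}" for x
  have "f x = (\<Sum>S\<in>P. \<Sum>T\<in>Q. of_bool (S \<union> T \<subseteq> x))" for x
  proof -
    have "f x = (\<Sum>S\<in>P. of_bool (S \<subseteq> x)) * (\<Sum>T\<in>Q. of_bool (T \<subseteq> x))"
      using fin by (simp add: f_def Int_def)
    also have "\<dots> = (\<Sum>S\<in>P. \<Sum>T\<in>Q. of_bool (S \<union> T \<subseteq> x))"
      unfolding sum_product by (simp add: of_bool_conj)
    finally show ?thesis .
  qed
  then have "(\<Sum>x\<in>points m. f x) = (\<Sum>x\<in>points m. \<Sum>S\<in>P. \<Sum>T\<in>Q. of_bool (S \<union> T \<subseteq> x))" by simp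
  also have "\<dots> = (\<Sum>S\<in>P. \<Sum>T\<in>Q. \<Sum>x\<in>points m. of_bool (S \<union> T \<subseteq> x))"
    by (subst sum.swap) (intro sum.cong refl sum.swap)
  also have "\<dots> = (\<Sum>S\<in>P. \<Sum>T\<in>Q. card {x. S \<union> T \<subseteq> x \<and> x \<subseteq> {..<m}})"
    by (intro sum.cong refl) (auto simp: Int_def points_def intro!: arg_cong[of _ _ card])
  finally have sum: "(\<Sum>x\<in>points m. f x) = (\<Sum>S\<in>P. \<Sum>T\<in>Q. card {x. S \<union> T \<subseteq> x \<and> x \<subseteq> {..<m}})" .
  have "even (card {x. S \<union> T \<subseteq> x \<and> x \<subseteq> {..<m}})" if "S \<in> P" "T \<in> Q" for S T
  proof -
    have S: "S \<subseteq> {..<m}" "card S \<le> d" and T: "T \<subseteq> {..<m}" "card T \<le> r"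
      using that P Q by (auto simp: mons_def)
    have "card (S \<union> T) < m" using card_Un_le[of S T] S T dr by linarith
    then show ?thesis using card_supersets[of "{..<m}" "S \<union> T"] S T by simp
  qed
  then have "even (\<Sum>x\<in>points m. f x)" unfolding sum by (intro dvd_sum) auto
  then have "even (card {x \<in> points m. odd (f x)})" by (simp add: even_sum_iff)
  moreover have "{x \<in> points m. odd (f x)} = {x \<in> points m. pval P x \<and> pval Q x}"
    by (simp add: f_def pval_def)
  ultimately show ?thesis by simp
qed

definition vanishing :: "nat \<Rightarrow> nat \<Rightarrow> nat set set \<Rightarrow> nat set set set" where
  "vanishing m r Z = {Q. Q \<subseteq> mons m r \<and> (\<forall>x\<in>Z. \<not> pval Q x)}"

lemma finite_vanishing [simp]: "finite (vanishing m r Z)"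
  by (rule finite_subset[of _ "Pow (mons m r)"]) (auto simp: vanishing_def)

text \<open>Rank-nullity in counting form: the nonempty fibres of the restriction map to Z are
  translates of its kernel \<open>vanishing m r Z\<close>. \<open>Y\<close> may be any set
  containing the image.\<close>

lemma card_image_times_vanishing:
  assumes "finite Y" "\<And>Q. Q \<subseteq> mons m r \<Longrightarrow> {x \<in> Z. pval Q x} \<in> Y"
  shows "2 ^ card (mons m r) \<le> card Y * card (vanishing m r Z)"
proof -
  have Pow_eq: "Pow (mons m r) = (\<Union>y\<in>Y. {Q \<in> Pow (mons m r). {x \<in> Z. pval Q x} = y})"
    using assms(2) by blast
  have "2 ^ card (mons m r) = card (\<Union>y\<in>Y. {Q \<in> Pow (mons m r). {x \<in> Z. pval Q x} = y})"
    by (simp only: Pow_eq[symmetric] card_Pow[OF finite_mons])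
  also have "\<dots> \<le> (\<Sum>y\<in>Y. card {Q \<in> Pow (mons m r). {x \<in> Z. pval Q x} = y})"
    using assms(1) by (rule card_UN_le)
  also have "\<dots> \<le> (\<Sum>y\<in>Y. card (vanishing m r Z))"
  proof (rule sum_mono)
    fix y
    let ?F = "{Q \<in> Pow (mons m r). {x \<in> Z. pval Q x} = y}"
    show "card ?F \<le> card (vanishing m r Z)"
    proof (cases "?F = {}")
      case False
      then obtain Q0 where Q0: "Q0 \<subseteq> mons m r" "{x \<in> Z. pval Q0 x} = y" by blast
      show ?thesis
      proof (rule card_inj_on_le[where f = "\<lambda>Q. sym_diff Q Q0"])
        show "inj_on (\<lambda>Q. sym_diff Q Q0) ?F"
          by (rule inj_on_inverseI[where g = "\<lambda>Q. sym_diff Q Q0"]) blast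
        show "(\<lambda>Q. sym_diff Q Q0) ` ?F \<subseteq> vanishing m r Z"
        proof
          fix R assume "R \<in> (\<lambda>Q. sym_diff Q Q0) ` ?F"
          then obtain Q where Q: "Q \<subseteq> mons m r" "{x \<in> Z. pval Q x} = y" "R = sym_diff Q Q0" by blast
          have "finite Q" "finite Q0" using Q Q0 finite_mons finite_subset by blast+
          then have "pval R x \<longleftrightarrow> pval Q x \<noteq> pval Q0 x" for x unfolding Q(3) by (rule pval_sym_diff)
          moreover have "pval Q x = pval Q0 x" if "x \<in> Z" for x using Q(2) Q0(2) that by blast
          moreover have "R \<subseteq> mons m r" unfolding Q(3) using Q(1) Q0(1) by blast
          ultimately show "R \<in> vanishing m r Z" by (simp add: vanishing_def)
        qed
      qed simp
    qed (simp only: card.empty)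
  qed
  finally show ?thesis by simp
qed

lemma card_vanishing_ge:
  assumes "finite Z"
  shows "2 ^ card (mons m r) \<le> 2 ^ card Z * card (vanishing m r Z)"
  using card_image_times_vanishing[of "Pow Z" m r Z] assms by (auto simp: card_Pow)

text \<open>Toggling one fixed element of C changes the parity.\<close>

lemma card_even_inter:
  assumes "finite Z" "C \<subseteq> Z" "C \<noteq> {}"
  shows "2 * card {Y. Y \<subseteq> Z \<and> even (card (Y \<inter> C))} \<le> 2 ^ card Z"
proof -
  obtain c where c: "c \<in> C" using assms by blast
  have fin: "finite {Y. Y \<subseteq> Z \<and> p Y}" for p
    by (rule finite_subset[of _ "Pow Z"]) (use assms in auto)
  have "card {Y. Y \<subseteq> Z \<and> even (card (Y \<inter> C))} \<le> card {Y. Y \<subseteq> Z \<and> odd (card (Y \<inter> C))}"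
  proof (rule card_inj_on_le[where f = "\<lambda>Y. sym_diff Y {c}"])
    show "inj_on (\<lambda>Y. sym_diff Y {c}) {Y. Y \<subseteq> Z \<and> even (card (Y \<inter> C))}"
      by (rule inj_on_inverseI[where g = "\<lambda>Y. sym_diff Y {c}"]) blast
    show "(\<lambda>Y. sym_diff Y {c}) ` {Y. Y \<subseteq> Z \<and> even (card (Y \<inter> C))} \<subseteq> {Y. Y \<subseteq> Z \<and> odd (card (Y \<inter> C))}"
    proof
      fix X assume "X \<in> (\<lambda>Y. sym_diff Y {c}) ` {Y. Y \<subseteq> Z \<and> even (card (Y \<inter> C))}"
      then obtain Y where Y: "Y \<subseteq> Z" "even (card (Y \<inter> C))" "X = sym_diff Y {c}" by blast
      have "X \<inter> C = sym_diff (Y \<inter> C) {c}" unfolding Y(3) using c by blast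
      moreover have "finite (Y \<inter> C)" using Y(1) assms finite_subset by blast
      ultimately have "odd (card (X \<inter> C))" using odd_card_sym_diff[of "Y \<inter> C" "{c}"] Y(2) by simp
      moreover have "X \<subseteq> Z" unfolding Y(3) using Y(1) c assms(2) by blast
      ultimately show "X \<in> {Y. Y \<subseteq> Z \<and> odd (card (Y \<inter> C))}" by simp
    qed
  qed (rule fin)
  moreover have "card {Y. Y \<subseteq> Z \<and> even (card (Y \<inter> C))} + card {Y. Y \<subseteq> Z \<and> odd (card (Y \<inter> C))}
      = card (Pow Z)"
    by (subst card_Un_disjoint[symmetric]) (auto intro!: fin arg_cong[of _ _ card])
  ultimately show ?thesis using assms(1) by (simp add: card_Pow)
qed

text \<open>Failure means that Z contains the support C of a nonzero codeword. By duality every Q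
  has an even number of ones on C, so the restrictions to Z lie in a hyperplane and the kernel is at
  least twice as large as the trivial bound.\<close>

lemma card_vanishing_ge_if_not_recovers:
  assumes "\<not> recovers_erasure m d Z" "Z \<subseteq> points m" "d + r < m"
  shows "2 * 2 ^ card (mons m r) \<le> 2 ^ card Z * card (vanishing m r Z)"
proof -
  obtain P1 P2 where P: "P1 \<subseteq> mons m d" "P2 \<subseteq> mons m d"
    and eq: "\<forall>x\<in>points m - Z. eval_poly m P1 x = eval_poly m P2 x"
    and ne: "eval_poly m P1 \<noteq> eval_poly m P2"
    using assms(1) unfolding recovers_erasure_def RM_def mons_def by blast
  define D where "D = sym_diff P1 P2"
  have D: "D \<subseteq> mons m d" using P unfolding D_def by blast
  have "finite P1" "finite P2" using P finite_mons finite_subset by blast+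
  then have pv: "pval D x \<longleftrightarrow> pval P1 x \<noteq> pval P2 x" for x unfolding D_def by (rule pval_sym_diff)
  have ev: "eval_poly m P' x \<longleftrightarrow> x \<in> points m \<and> pval P' x" for P' x
    by (simp add: eval_poly_def pval_def)
  define C where "C = {x \<in> points m. pval D x}"
  have "C \<subseteq> Z" using eq by (auto simp: C_def pv ev)
  have "C \<noteq> {}" using ne by (auto simp: C_def pv ev fun_eq_iff)
  have finZ: "finite Z" using assms(2) finite_subset finite_points by blast
  have "2 ^ card (mons m r) \<le> card {Y. Y \<subseteq> Z \<and> even (card (Y \<inter> C))} * card (vanishing m r Z)"
  proof (rule card_image_times_vanishing)
    show "finite {Y. Y \<subseteq> Z \<and> even (card (Y \<inter> C))}"
      by (rule finite_subset[of _ "Pow Z"]) (use finZ in auto)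
    fix Q assume "Q \<subseteq> mons m r"
    then have "even (card {x \<in> points m. pval D x \<and> pval Q x})" using RM_dual D assms(3) by blast
    moreover have "{x \<in> points m. pval D x \<and> pval Q x} = {x \<in> Z. pval Q x} \<inter> C"
      using \<open>C \<subseteq> Z\<close> by (auto simp: C_def)
    ultimately show "{x \<in> Z. pval Q x} \<in> {Y. Y \<subseteq> Z \<and> even (card (Y \<inter> C))}" by auto
  qed
  then have "2 * 2 ^ card (mons m r) \<le> (2 * card {Y. Y \<subseteq> Z \<and> even (card (Y \<inter> C))}) * card (vanishing m r Z)"
    by simp
  also have "\<dots> \<le> 2 ^ card Z * card (vanishing m r Z)"
    using card_even_inter[OF finZ \<open>C \<subseteq> Z\<close> \<open>C \<noteq> {}\<close>] by (rule mult_right_mono) simp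
  finally show ?thesis .
qed

text \<open>Sampling without replacement stays in a set of density a/n no more often than sampling
  with replacement, since (a-k)/(n-k) <= a/n.\<close>

lemma binomial_ratio_le_power:
  assumes "a \<le> n"
  shows "(a choose k) * n ^ k \<le> (n choose k) * a ^ k"
proof (induction k)
  case (Suc k)
  have abs: "Suc k * (b choose Suc k) = (b - k) * (b choose k)" for b
    using binomial_absorption[of k b] binomial_absorb_comp[of b k] by simp
  have "(a - k) * n \<le> (n - k) * a"
    using assms by (simp add: diff_mult_distrib algebra_simps diff_le_mono2)
  have "Suc k * ((a choose Suc k) * n ^ Suc k) = ((a - k) * n) * ((a choose k) * n ^ k)"
  proof -
    have "Suc k * ((a choose Suc k) * n ^ Suc k) = (Suc k * (a choose Suc k)) * (n * n ^ k)"
      by (simp only: power_Suc mult.assoc)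
    then show ?thesis unfolding abs by (simp only: ac_simps)
  qed
  also have "\<dots> \<le> ((n - k) * a) * ((n choose k) * a ^ k)"
    using \<open>(a - k) * n \<le> (n - k) * a\<close> Suc.IH by (rule mult_mono) auto
  also have "\<dots> = Suc k * ((n choose Suc k) * a ^ Suc k)"
  proof -
    have "Suc k * ((n choose Suc k) * a ^ Suc k) = (Suc k * (n choose Suc k)) * (a * a ^ k)"
      by (simp only: power_Suc mult.assoc)
    then show ?thesis unfolding abs by (simp only: ac_simps)
  qed
  finally show ?case by (simp only: mult_le_cancel1)
qed simp

lemma recovery_prob_ge:
  assumes "d + r < m" "K \<le> 2 ^ m"
  shows "recovery_prob m d K
    \<ge> 2 - 2 ^ K / 2 ^ card (mons m r) * (\<Sum>P\<in>Pow (mons m r). (1 - weight m P / 2 ^ m) ^ K)"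
proof -
  define A where "A = {Z. Z \<subseteq> points m \<and> card Z = K}"
  define good where "good = {Z. Z \<subseteq> points m \<and> card Z = K \<and> recovers_erasure m d Z}"
  define R where "R = card (mons m r)"
  define \<Sigma> where "\<Sigma> = (\<Sum>P\<in>Pow (mons m r). (1 - weight m P / 2 ^ m) ^ K)"
  have finA: "finite A" by (rule finite_subset[of _ "Pow (points m)"]) (auto simp: A_def)
  have cardA: "card A = (2 ^ m choose K)" unfolding A_def by (subst n_subsets) (simp_all add: card_points)
  have A0: "card A > 0" unfolding cardA using assms(2) by (simp add: zero_less_binomial)
  have goodA: "good \<subseteq> A" by (auto simp: good_def A_def)
  \<comment> \<open>The factor is 1 for correctable Z and 2 for the others, the two lower bounds on
    the kernel size. Averaged over Z it is 2 minus the recovery probability.\<close>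
  have "(2 * real (card A) - card good) * 2 ^ R = (\<Sum>Z\<in>A. (2 - of_bool (Z \<in> good)) * 2 ^ R)"
    using finA goodA by (simp add: sum_subtractf sum_distrib_right[symmetric] Int_absorb1)
  also have "\<dots> \<le> (\<Sum>Z\<in>A. 2 ^ K * real (card (vanishing m r Z)))"
  proof (rule sum_mono)
    fix Z assume Z: "Z \<in> A"
    then have fin: "finite Z" using finite_subset[OF _ finite_points] by (auto simp: A_def)
    have K: "card Z = K" "Z \<subseteq> points m" using Z by (auto simp: A_def)
    show "(2 - of_bool (Z \<in> good)) * 2 ^ R \<le> 2 ^ K * real (card (vanishing m r Z))"
    proof (cases "Z \<in> good")
      case True
      have "real (2 ^ R) \<le> real (2 ^ K * card (vanishing m r Z))"
        using card_vanishing_ge[OF fin, of m r] unfolding of_nat_le_iff R_def K .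
      then show ?thesis using True by simp
    next
      case False
      then have "\<not> recovers_erasure m d Z" using K by (auto simp: good_def)
      then have "real (2 * 2 ^ R) \<le> real (2 ^ K * card (vanishing m r Z))"
        using card_vanishing_ge_if_not_recovers[OF _ K(2) assms(1)] unfolding of_nat_le_iff R_def K by blast
      then show ?thesis using False by simp
    qed
  qed
  also have "\<dots> = 2 ^ K * (\<Sum>Z\<in>A. \<Sum>P\<in>Pow (mons m r). of_bool (\<forall>x\<in>Z. \<not> pval P x))"
    by (simp add: sum_distrib_left vanishing_def Int_def)
  also have "\<dots> = 2 ^ K * (\<Sum>P\<in>Pow (mons m r). \<Sum>Z\<in>A. of_bool (\<forall>x\<in>Z. \<not> pval P x))"
    by (subst sum.swap) simp
  also have "\<dots> \<le> 2 ^ K * (\<Sum>P\<in>Pow (mons m r). card A * (1 - weight m P / 2 ^ m) ^ K)"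
  proof (intro mult_left_mono sum_mono)
    fix P
    define n0 where "n0 = card {x \<in> points m. \<not> pval P x}"
    have "{x \<in> points m. \<not> pval P x} \<union> {x \<in> points m. pval P x} = points m" by blast
    then have "card (points m) = n0 + weight m P"
      unfolding n0_def weight_def by (subst card_Un_disjoint[symmetric]) auto
    then have n0: "n0 + weight m P = 2 ^ m" by (simp add: card_points)
    then have n0': "real n0 + weight m P = 2 ^ m" by (simp only: of_nat_add[symmetric]) simp
    have "(\<Sum>Z\<in>A. of_bool (\<forall>x\<in>Z. \<not> pval P x)) = real (card {Z \<in> A. \<forall>x\<in>Z. \<not> pval P x})"
      using finA by (simp add: Int_def)
    also have "{Z \<in> A. \<forall>x\<in>Z. \<not> pval P x} = {Z. Z \<subseteq> {x \<in> points m. \<not> pval P x} \<and> card Z = K}"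
      by (auto simp: A_def)
    also have "card \<dots> = (n0 choose K)" unfolding n0_def by (rule n_subsets) simp
    finally have eq: "(\<Sum>Z\<in>A. of_bool (\<forall>x\<in>Z. \<not> pval P x)) = real (n0 choose K)" .
    have "real ((n0 choose K) * (2 ^ m) ^ K) \<le> real ((2 ^ m choose K) * n0 ^ K)"
      unfolding of_nat_le_iff using n0 by (intro binomial_ratio_le_power) simp
    then have "real (n0 choose K) \<le> card A * (real n0 / 2 ^ m) ^ K"
      by (simp add: cardA power_divide field_simps)
    also have "real n0 / 2 ^ m = 1 - weight m P / 2 ^ m" using n0' by (simp add: field_simps)
    finally show "(\<Sum>Z\<in>A. of_bool (\<forall>x\<in>Z. \<not> pval P x)) \<le> card A * (1 - weight m P / 2 ^ m) ^ K"
      unfolding eq .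
  qed simp
  also have "\<dots> = card A * (2 ^ K * \<Sigma>)" by (simp add: \<Sigma>_def sum_distrib_left mult.left_commute)
  finally have "(2 * real (card A) - card good) * 2 ^ R \<le> card A * (2 ^ K * \<Sigma>)" .
  then have "2 - real (card good) / card A \<le> 2 ^ K / 2 ^ R * \<Sigma>"
    using A0 by (simp add: field_simps)
  then show ?thesis unfolding recovery_prob_def R_def \<Sigma>_def good_def A_def by simp
qed

section \<open>Partial binomial sums\<close>

text \<open>A fixed variable lies in at most a fraction r/m of the monomials of degree at most r;
  layer by layer this is the absorption identity.\<close>

lemma binom_le_remove_both:
  assumes "0 < m" "0 < r"
  shows "m * binom_le (m - 1) (r - 1) \<le> r * binom_le m r"
proof -
  have "m * binom_le (m - 1) (r - 1) = (\<Sum>j\<le>r - 1. m * ((m - 1) choose j))"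
    by (simp add: binom_le_def sum_distrib_left)
  also have "\<dots> = (\<Sum>j\<le>r - 1. Suc j * (m choose Suc j))"
    by (simp only: binomial_absorption)
  also have "\<dots> \<le> (\<Sum>j\<le>r - 1. r * (m choose Suc j))"
    using assms(2) by (intro sum_mono mult_right_mono) auto
  also have "\<dots> = r * (\<Sum>j\<in>Suc ` {..r - 1}. m choose j)"
    by (simp add: sum_distrib_left sum.reindex)
  also have "\<dots> \<le> r * binom_le m r"
    unfolding binom_le_def using assms(2) by (intro mult_left_mono sum_mono2) auto
  finally show ?thesis .
qed

lemma binom_le_remove_both_power:
  assumes "k \<le> r" "r \<le> m"
  shows "real (binom_le (m - k) (r - k)) \<le> (r / m) ^ k * binom_le m r"
  using assms
proof (induction k)
  case (Suc k)
  have mk: "0 < m - k" "0 < r - k" using Suc.prems by auto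
  have "real ((m - k) * binom_le (m - k - 1) (r - k - 1)) \<le> real ((r - k) * binom_le (m - k) (r - k))"
    unfolding of_nat_le_iff using binom_le_remove_both[OF mk] .
  then have "real (binom_le (m - Suc k) (r - Suc k)) \<le> real (r - k) / real (m - k) * binom_le (m - k) (r - k)"
    using mk by (simp add: field_simps)
  also have "\<dots> \<le> (r / m) * binom_le (m - k) (r - k)"
  proof (rule mult_right_mono)
    have "real k * r \<le> real k * m" using Suc.prems by (intro mult_left_mono) auto
    then show "real (r - k) / real (m - k) \<le> r / m" using Suc.prems mk
      by (simp add: of_nat_diff field_simps)
  qed simp
  also have "\<dots> \<le> (r / m) * ((r / m) ^ k * binom_le m r)"
    using Suc by (intro mult_left_mono) auto
  finally show ?case by simp
qed simp

lemma card_mons_superset: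
  assumes "J \<subseteq> {..<m}" "r \<le> m"
  shows "real (card {S \<in> mons m r. J \<subseteq> S}) \<le> (r / m) ^ card J * binom_le m r"
proof (cases "card J \<le> r")
  case False
  have "{S \<in> mons m r. J \<subseteq> S} = {}"
  proof (rule ccontr)
    assume "{S \<in> mons m r. J \<subseteq> S} \<noteq> {}"
    then obtain S where S: "S \<subseteq> {..<m}" "card S \<le> r" "J \<subseteq> S" by (auto simp: mons_def)
    then have "card J \<le> card S" using finite_subset by (intro card_mono) auto
    then show False using S False by simp
  qed
  then show ?thesis by (simp only: card.empty) simp
next
  case True
  have finJ: "finite J" using assms finite_subset by blast
  define k where "k = card J"
  have "card {S \<in> mons m r. J \<subseteq> S} \<le> card (\<Union>j\<in>{..r - k}. {T. T \<subseteq> {..<m} - J \<and> card T = j})"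
  proof (rule card_inj_on_le[where f = "\<lambda>S. S - J"])
    show "inj_on (\<lambda>S. S - J) {S \<in> mons m r. J \<subseteq> S}"
      by (rule inj_on_inverseI[where g = "\<lambda>S. S \<union> J"]) auto
    show "(\<lambda>S. S - J) ` {S \<in> mons m r. J \<subseteq> S} \<subseteq> (\<Union>j\<in>{..r - k}. {T. T \<subseteq> {..<m} - J \<and> card T = j})"
      using finJ by (auto simp: mons_def card_Diff_subset k_def)
    show "finite (\<Union>j\<in>{..r - k}. {T. T \<subseteq> {..<m} - J \<and> card T = j})"
      by (rule finite_subset[of _ "Pow {..<m}"]) auto
  qed
  also have "\<dots> \<le> (\<Sum>j\<le>r - k. card {T. T \<subseteq> {..<m} - J \<and> card T = j})"
    by (rule card_UN_le) simp
  also have "\<dots> = binom_le (m - k) (r - k)"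
    using assms finJ by (simp add: n_subsets binom_le_def card_Diff_subset k_def)
  finally have "real (card {S \<in> mons m r. J \<subseteq> S}) \<le> binom_le (m - k) (r - k)" by simp
  also have "\<dots> \<le> (r / m) ^ k * binom_le m r"
    using True assms by (intro binom_le_remove_both_power) (auto simp: k_def)
  finally show ?thesis by (simp add: k_def)
qed

text \<open>Union bound over the k-subsets of the block, at most 2^t in number. It is useful as long
  as (r/m)^k beats 2^t.\<close>

lemma card_mons_meeting_block:
  assumes "t \<le> m" "r \<le> m"
  shows "real (card {S \<in> mons m r. k \<le> card (S \<inter> {..<t})}) \<le> 2 ^ t * (r / m) ^ k * binom_le m r"
proof -
  define \<J> where "\<J> = {J. J \<subseteq> {..<t} \<and> card J = k}"
  have fin: "finite \<J>" by (rule finite_subset[of _ "Pow {..<t}"]) (auto simp: \<J>_def)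
  have "card \<J> \<le> card (Pow {..<t})" by (intro card_mono) (auto simp: \<J>_def)
  then have "card \<J> \<le> 2 ^ t" by (simp add: card_Pow)
  then have card\<J>: "real (card \<J>) \<le> 2 ^ t" by (metis of_nat_le_iff of_nat_numeral of_nat_power)
  have "{S \<in> mons m r. k \<le> card (S \<inter> {..<t})} \<subseteq> (\<Union>J\<in>\<J>. {S \<in> mons m r. J \<subseteq> S})"
  proof
    fix S assume S: "S \<in> {S \<in> mons m r. k \<le> card (S \<inter> {..<t})}"
    then obtain J where "J \<subseteq> S \<inter> {..<t}" "card J = k"
      by (metis (no_types, lifting) mem_Collect_eq obtain_subset_with_card_n)
    then show "S \<in> (\<Union>J\<in>\<J>. {S \<in> mons m r. J \<subseteq> S})" using S by (auto simp: \<J>_def)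
  qed
  then have "card {S \<in> mons m r. k \<le> card (S \<inter> {..<t})} \<le> card (\<Union>J\<in>\<J>. {S \<in> mons m r. J \<subseteq> S})"
    using fin by (intro card_mono) auto
  also have "\<dots> \<le> (\<Sum>J\<in>\<J>. card {S \<in> mons m r. J \<subseteq> S})" using fin by (rule card_UN_le)
  finally have "real (card {S \<in> mons m r. k \<le> card (S \<inter> {..<t})}) \<le> (\<Sum>J\<in>\<J>. real (card {S \<in> mons m r. J \<subseteq> S}))"
    unfolding of_nat_sum[symmetric] of_nat_le_iff .
  also have "\<dots> \<le> (\<Sum>J\<in>\<J>. (r / m) ^ k * binom_le m r)"
  proof (rule sum_mono)
    fix J assume "J \<in> \<J>"
    then have "J \<subseteq> {..<m}" "card J = k" using assms by (auto simp: \<J>_def)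
    then show "real (card {S \<in> mons m r. J \<subseteq> S}) \<le> (r / m) ^ k * binom_le m r"
      using card_mons_superset[of J m r] assms by simp
  qed
  also have "\<dots> = card \<J> * ((r / m) ^ k * binom_le m r)" by simp
  also have "\<dots> \<le> 2 ^ t * ((r / m) ^ k * binom_le m r)" using card\<J> by (intro mult_right_mono) auto
  finally show ?thesis by (simp add: mult.assoc)
qed

lemma binom_le_remove:
  assumes "0 < m"
  shows "(1 - r / m) * binom_le m r \<le> binom_le (m - 1) r"
proof -
  have "(real m - real r) * binom_le m r \<le> real m * binom_le (m - 1) r"
  proof -
    have "(real m - real r) * binom_le m r = (\<Sum>j\<le>r. (real m - real r) * (m choose j))"
      by (simp add: binom_le_def sum_distrib_left)
    also have "\<dots> \<le> (\<Sum>j\<le>r. real m * ((m - 1) choose j))"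
    proof (rule sum_mono)
      fix j assume "j \<in> {..r}"
      then have "(real m - real r) * (m choose j) \<le> real (m - j) * (m choose j)"
        by (intro mult_right_mono) auto
      also have "\<dots> = real m * ((m - 1) choose j)"
        by (metis binomial_absorb_comp of_nat_mult)
      finally show "(real m - real r) * (m choose j) \<le> real m * ((m - 1) choose j)" .
    qed
    also have "\<dots> = real m * binom_le (m - 1) r" by (simp add: binom_le_def sum_distrib_left)
    finally show ?thesis .
  qed
  then show ?thesis using assms by (simp add: field_simps)
qed

text \<open>With i variables removed, the fraction of monomials using the next one is at most
  r/(m-i), which stays below 2r/m until half of the variables are gone.\<close>

lemma binom_le_remove_power:
  assumes "2 * t \<le> m" "2 * r \<le> m" "0 < m"
  shows "(1 - 2 * r / m) ^ t * binom_le m r \<le> binom_le (m - t) r"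
  using assms(1)
proof (induction t)
  case (Suc t)
  have mt: "0 < m - t" using Suc.prems by auto
  have nn: "0 \<le> 1 - 2 * r / m" using assms(2,3) by (simp add: field_simps)
  have "(1 - 2 * r / m) ^ Suc t * binom_le m r = (1 - 2 * r / m) * ((1 - 2 * r / m) ^ t * binom_le m r)"
    by simp
  also have "\<dots> \<le> (1 - 2 * r / m) * binom_le (m - t) r"
    using Suc nn by (intro mult_left_mono) auto
  also have "\<dots> \<le> (1 - r / real (m - t)) * binom_le (m - t) r"
  proof (rule mult_right_mono)
    have "real r * m \<le> real r * (2 * real (m - t))"
      using Suc.prems by (intro mult_left_mono) (auto simp: of_nat_diff)
    then show "1 - 2 * r / m \<le> 1 - r / real (m - t)" using mt assms(3) by (simp add: field_simps)
  qed simp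
  also have "\<dots> \<le> binom_le (m - t - 1) r" using mt by (rule binom_le_remove)
  finally show ?case by simp
qed simp

text \<open>Near weight 1/2 the block grows and the union bound would exceed the total. Counting the
  monomials that avoid the block, by shifting indices by t, keeps the fraction below 1.\<close>

lemma card_mons_meeting_block_one:
  assumes "2 * t \<le> m" "2 * r \<le> m" "0 < m"
  shows "real (card {S \<in> mons m r. 1 \<le> card (S \<inter> {..<t})}) \<le> (1 - (1 - 2 * r / m) ^ t) * binom_le m r"
proof -
  have "binom_le (m - t) r \<le> card {S \<in> mons m r. S \<inter> {..<t} = {}}"
  proof -
    have "binom_le (m - t) r = card (mons (m - t) r)" by (rule card_mons[symmetric])
    also have "\<dots> \<le> card {S \<in> mons m r. S \<inter> {..<t} = {}}"
    proof (rule card_inj_on_le[where f = "\<lambda>S. (\<lambda>i. i + t) ` S"])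
      show "inj_on ((`) (\<lambda>i. i + t)) (mons (m - t) r)"
        by (intro inj_onI) (simp add: inj_image_eq_iff)
      show "(`) (\<lambda>i. i + t) ` mons (m - t) r \<subseteq> {S \<in> mons m r. S \<inter> {..<t} = {}}"
      proof
        fix S assume "S \<in> (`) (\<lambda>i. i + t) ` mons (m - t) r"
        then obtain S' where S': "S' \<subseteq> {..<m - t}" "card S' \<le> r" "S = (\<lambda>i. i + t) ` S'"
          by (auto simp: mons_def)
        moreover have "card S = card S'" unfolding S'(3) by (rule card_image) simp
        ultimately show "S \<in> {S \<in> mons m r. S \<inter> {..<t} = {}}" by (auto simp: mons_def)
      qed
    qed simp
    finally show ?thesis .
  qed
  moreover have "card {S \<in> mons m r. 1 \<le> card (S \<inter> {..<t})} + card {S \<in> mons m r. S \<inter> {..<t} = {}}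
      = binom_le m r"
  proof -
    have "1 \<le> card (S \<inter> {..<t}) \<longleftrightarrow> S \<inter> {..<t} \<noteq> {}" for S
      by (simp add: Suc_le_eq card_gt_0_iff)
    then have "{S \<in> mons m r. 1 \<le> card (S \<inter> {..<t})} \<union> {S \<in> mons m r. S \<inter> {..<t} = {}} = mons m r"
      "{S \<in> mons m r. 1 \<le> card (S \<inter> {..<t})} \<inter> {S \<in> mons m r. S \<inter> {..<t} = {}} = {}" by auto
    then show ?thesis unfolding card_mons[symmetric]
      by (subst card_Un_disjoint[symmetric]) auto
  qed
  ultimately have "real (card {S \<in> mons m r. 1 \<le> card (S \<inter> {..<t})}) + binom_le (m - t) r \<le> binom_le m r"
    by (simp only: of_nat_add[symmetric] of_nat_le_iff)
  then show ?thesis using binom_le_remove_power[OF assms] by (simp add: left_diff_distrib)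
qed

text \<open>Chernoff-type estimate: x^r <= x^j for j <= r, then the binomial theorem.\<close>

lemma binom_le_power_le:
  assumes "0 < x" "x \<le> (1::real)"
  shows "x ^ r * binom_le m r \<le> (1 + x) ^ m"
proof -
  have "x ^ r * binom_le m r = (\<Sum>j\<le>r. (m choose j) * x ^ r)"
    by (simp add: binom_le_def sum_distrib_left mult.commute)
  also have "\<dots> = (\<Sum>j\<in>{..r} \<inter> {..m}. (m choose j) * x ^ r)"
    by (rule sum.mono_neutral_right) auto
  also have "\<dots> \<le> (\<Sum>j\<in>{..r} \<inter> {..m}. (m choose j) * x ^ j)"
    using assms by (intro sum_mono mult_left_mono power_decreasing) auto
  also have "\<dots> \<le> (\<Sum>j\<le>m. (m choose j) * x ^ j)"
    using assms by (intro sum_mono2) auto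
  also have "\<dots> = (x + 1) ^ m" by (subst binomial_ring) simp
  finally show ?thesis by (simp add: add.commute)
qed

lemma half_le_ln_2: "1 / 2 \<le> ln (2::real)"
  using ln_le_minus_one[of "1 / 2 :: real"] by (simp add: ln_div)

lemma ln_2_le_one: "ln (2::real) \<le> 1"
  using ln_le_minus_one[of "2 :: real"] by simp

lemma powr_power_two: "(2 powr a) ^ n = 2 powr (a * real n)" for a :: real
  by (metis powr_gt_zero powr_powr powr_realpow zero_neq_numeral)

text \<open>Needed so that a block of length proportional to log R fits into m variables. The choice
  x = 1/128 costs 7r + m/64 in the exponent, below m/40.\<close>

lemma binom_le_small:
  assumes "2 ^ 40 * r \<le> m"
  shows "real (binom_le m r) \<le> 2 powr (m / 40)"
proof -
  have "real (2 ^ 40 * r) \<le> m" using assms unfolding of_nat_le_iff .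
  then have r: "2 ^ 40 * real r \<le> m" by simp
  have "(1 / 128) ^ r * real (binom_le m r) \<le> (1 + 1 / 128) ^ m" by (rule binom_le_power_le) auto
  then have "real (binom_le m r) \<le> 128 ^ r * (1 + 1 / 128) ^ m" by (simp add: field_simps power_divide)
  also have "\<dots> \<le> 128 ^ r * exp (1 / 128) ^ m"
    by (intro mult_left_mono power_mono exp_ge_add_one_self) auto
  also have "exp (1 / 128) \<le> 2 powr (1 / 64 :: real)"
    using half_le_ln_2 by (simp add: powr_def)
  then have "128 ^ r * exp (1 / 128) ^ m \<le> 128 ^ r * (2 powr (1 / 64 :: real)) ^ m"
    by (intro mult_left_mono power_mono) auto
  also have "\<dots> = (2 powr 7) ^ r * (2 powr (1 / 64 :: real)) ^ m" by simp
  also have "\<dots> = 2 powr (7 * r + m / 64)"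
    unfolding powr_power_two powr_add by simp
  also have "\<dots> \<le> 2 powr (m / 40)"
  proof -
    have "7 * real r + m / 64 \<le> m / 40" using r by simp
    then show ?thesis by simp
  qed
  finally show ?thesis by simp
qed

section \<open>The sum over the weight layers\<close>

text \<open>Base-2 form with error rate a = 2^(-j), so that all contributions add up in one
  exponent. By 1 <= 2 ln 2 each of the two small subsets costs at most R (j+2) / 2^j bits;
  \<open>c\<close> is left open because the two weight regimes bound the high monomials
  differently.\<close>

lemma card_low_weight_powr:
  fixes w c :: real
  assumes "t \<le> m" "k \<ge> 1" "w \<ge> 0" "w < 1 / 2 ^ k" "w / (2 ^ t * (1 / 2 ^ k - w)\<^sup>2) \<le> 1 / 2 ^ Suc j"
    and W: "W \<subseteq> Pow (mons m r)" "\<And>P. P \<in> W \<Longrightarrow> real (weight m P) \<le> w * 2 ^ m"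
    and c: "real (card {S \<in> mons m r. k \<le> card (S \<inter> {..<t})}) \<le> c"
  shows "real (card W) \<le> 2 * 2 powr (c + binom_le m r * (2 * (real j + 2) / 2 ^ j))"
proof -
  define a :: real where "a = 1 / 2 ^ j"
  define R where "R = real (binom_le m r)"
  define s where "s = card {E. E \<subseteq> mons m r \<and> real (card E) \<le> a * card (mons m r)}"
  have a: "0 < a" "a \<le> 1" by (simp_all add: a_def)
  have "real s \<le> exp (R * (a + a * ln (1 / a)))"
    unfolding s_def R_def card_mons[symmetric] using a by (intro card_small_subsets) auto
  also have "ln (1 / a) = j * ln 2" by (simp add: a_def ln_realpow)
  also have "exp (R * (a + a * (j * ln 2))) \<le> exp (R * (a * (j + 2)) * ln 2)"
  proof -
    have "R * a * (1 + j * ln 2) \<le> R * a * ((j + 2) * ln 2)"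
      using a half_le_ln_2 by (intro mult_left_mono) (auto simp: R_def distrib_right)
    then show ?thesis by (simp add: algebra_simps)
  qed
  also have "\<dots> = 2 powr (R * (a * (j + 2)))" by (simp add: powr_def)
  finally have s: "real s \<le> 2 powr (R * (a * (j + 2)))" .
  have "card W \<le> 2 * (2 ^ card {S \<in> mons m r. k \<le> card (S \<inter> {..<t})} * s\<^sup>2)"
    unfolding s_def using assms(1-5) W a by (intro card_low_weight) (auto simp: a_def)
  then have "real (card W) \<le> 2 * (2 ^ card {S \<in> mons m r. k \<le> card (S \<inter> {..<t})} * (real s)\<^sup>2)"
    unfolding of_nat_le_iff[symmetric, where ?'a = real] by simp
  also have "\<dots> \<le> 2 * (2 powr c * (2 powr (R * (a * (j + 2))))\<^sup>2)"
    using s c by (intro mult_left_mono mult_mono power_mono) (auto simp: powr_realpow[symmetric])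
  also have "\<dots> = 2 * 2 powr (c + R * (2 * (real j + 2) / 2 ^ j))"
    unfolding powr_power_two powr_add[symmetric] a_def by (simp add: algebra_simps)
  finally show ?thesis unfolding R_def .
qed

text \<open>The share of the first-moment sum due to weights in [lo, hi]. Both ends are closed, so
  splitting counts the boundary twice, which is harmless for upper bounds.\<close>

definition layer :: "nat \<Rightarrow> nat \<Rightarrow> nat \<Rightarrow> real \<Rightarrow> real \<Rightarrow> real" where
  "layer m r K lo hi = (\<Sum>P | P \<in> Pow (mons m r) \<and> lo \<le> weight m P / 2 ^ m \<and> weight m P / 2 ^ m \<le> hi.
     2 ^ K / 2 ^ binom_le m r * (1 - weight m P / 2 ^ m) ^ K)"

lemma weight_frac_le_one: "weight m P / 2 ^ m \<le> (1 :: real)"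
proof -
  have "weight m P \<le> 2 ^ m" unfolding weight_def card_points[symmetric] by (rule card_mono) auto
  then have "real (weight m P) \<le> real (2 ^ m)" unfolding of_nat_le_iff .
  then show ?thesis by simp
qed

lemma layer_le:
  assumes "t \<le> m" "k \<ge> 1" "0 \<le> lo" "lo \<le> 1" "0 \<le> hi" "hi < 1 / 2 ^ k"
    and "hi / (2 ^ t * (1 / 2 ^ k - hi)\<^sup>2) \<le> 1 / 2 ^ Suc j"
    and "real (card {S \<in> mons m r. k \<le> card (S \<inter> {..<t})}) \<le> c"
  shows "layer m r K lo hi
     \<le> 2 * 2 powr (c + binom_le m r * (2 * (real j + 2) / 2 ^ j) - binom_le m r + K) * (1 - lo) ^ K"
proof -
  define W where "W = {P \<in> Pow (mons m r). lo \<le> weight m P / 2 ^ m \<and> weight m P / 2 ^ m \<le> hi}"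
  have "layer m r K lo hi \<le> (\<Sum>P\<in>W. 2 ^ K / 2 ^ binom_le m r * (1 - lo) ^ K)"
    unfolding layer_def W_def[symmetric]
    using weight_frac_le_one by (intro sum_mono mult_left_mono power_mono) (auto simp: W_def)
  also have "\<dots> = card W * (2 ^ K / 2 ^ binom_le m r * (1 - lo) ^ K)" by simp
  also have "\<dots> \<le> (2 * 2 powr (c + binom_le m r * (2 * (real j + 2) / 2 ^ j))) * (2 ^ K / 2 ^ binom_le m r * (1 - lo) ^ K)"
    using assms by (intro mult_right_mono card_low_weight_powr) (auto simp: W_def field_simps)
  also have "\<dots> = 2 * 2 powr (c + binom_le m r * (2 * (real j + 2) / 2 ^ j) - binom_le m r + K) * (1 - lo) ^ K"
    by (simp add: powr_add powr_diff powr_realpow)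
  finally show ?thesis .
qed

lemma layer_split:
  "layer m r K lo hi \<le> layer m r K lo mid + layer m r K mid hi"
proof -
  define f where "f P = 2 ^ K / 2 ^ binom_le m r * (1 - weight m P / 2 ^ m) ^ K" for P
  define A where "A lo hi = {P \<in> Pow (mons m r). lo \<le> weight m P / 2 ^ m \<and> weight m P / 2 ^ m \<le> hi}" for lo hi :: real
  have f: "0 \<le> f P" for P using weight_frac_le_one by (simp add: f_def)
  have fin: "finite (A lo hi)" for lo hi by (simp add: A_def)
  have "sum f (A lo hi) \<le> sum f (A lo mid \<union> A mid hi)"
    using f fin by (intro sum_mono2) (auto simp: A_def)
  also have "\<dots> \<le> sum f (A lo mid) + sum f (A mid hi)"
    using f fin sum.union_inter[of "A lo mid" "A mid hi" f] sum_nonneg[of "A lo mid \<inter> A mid hi" f]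
    by (smt (verit))
  finally show ?thesis unfolding layer_def f_def A_def by simp
qed

lemma one_minus_power_le_powr:
  fixes x :: real
  assumes "0 \<le> x" "x \<le> 1"
  shows "(1 - x) ^ K \<le> 2 powr (- (x * K))"
proof -
  have "(1 - x) ^ K \<le> exp (- x) ^ K"
    using assms exp_ge_add_one_self[of "- x"] by (intro power_mono) auto
  also have "\<dots> = exp (- (x * K))" by (simp add: exp_of_nat_mult[symmetric] mult.commute)
  also have "\<dots> \<le> exp (- (x * K) * ln 2)"
    using ln_2_le_one assms by (simp add: mult_left_le)
  also have "\<dots> = 2 powr (- (x * K))" by (simp add: powr_def)
  finally show ?thesis .
qed

lemma one_plus_power_le_powr:
  fixes x :: real
  assumes "0 \<le> x"
  shows "(1 + x) ^ K \<le> 2 powr (2 * x * K)"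
proof -
  have "(1 + x) ^ K \<le> exp x ^ K"
    using assms exp_ge_add_one_self[of x] by (intro power_mono) auto
  also have "\<dots> = exp (x * K * 1)" by (simp add: exp_of_nat_mult[symmetric] mult.commute)
  also have "\<dots> \<le> exp (x * K * (2 * ln 2))"
    using half_le_ln_2 assms by (subst exp_le_cancel_iff, intro mult_left_mono) auto
  also have "\<dots> = 2 powr (2 * x * K)" by (simp add: powr_def)
  finally show ?thesis .
qed

text \<open>The exponent per unit of R for t = 3s+2, k = s-1, j = 2s. The target is half of
  2^(-(s+1)), the saving on [2^(-(s+1)), 2^(-s)]. At s = 7 the first term alone already equals the
  target, hence s >= 8.\<close>

lemma exponent_low_weight_bound:
  fixes s :: nat
  assumes "8 \<le> s"
  shows "2 * (real (2 * s) + 2) / 2 ^ (2 * s) + 2 ^ (3 * s + 2) * (1 / 2 ^ 40) ^ (s - 1) \<le> (1 / 2 ^ (s + 2) :: real)"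
proof -
  obtain n where s: "s = n + 8" using assms le_Suc_ex by (metis add.commute)
  have n: "real n + 1 \<le> 2 ^ n" by (induction n) auto
  have e: "2 * s = n + n + 16" "3 * s + 2 = 3 * n + 26" "s - 1 = n + 7" by (simp_all add: s)
  have "2 * (real (2 * s) + 2) = 4 * (real n + 9)" by (simp add: s)
  also have "\<dots> \<le> 36 * 2 ^ n" using n of_nat_0_le_iff[of n, where ?'a = real] by (simp add: distrib_left)
  finally have "2 * (real (2 * s) + 2) / 2 ^ (2 * s) \<le> 36 * 2 ^ n / 2 ^ (2 * s)"
    by (intro divide_right_mono) auto
  also have "\<dots> = 36 / 2 ^ 16 * (1 / 2) ^ n"
    unfolding e power_add by (simp add: power_one_over)
  finally have 1: "2 * (real (2 * s) + 2) / 2 ^ (2 * s) \<le> 36 / 2 ^ 16 * (1 / 2) ^ n" .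
  define C :: real where "C = 2 ^ 26 * (1 / 2 ^ 40) ^ 7"
  have "2 ^ (3 * s + 2) * (1 / 2 ^ 40) ^ (s - 1) = C * (2 ^ 3 * (1 / 2 ^ 40)) ^ n"
    unfolding e power_add C_def power_mult power_mult_distrib by (simp only: ac_simps)
  also have "\<dots> \<le> C * (1 / 2) ^ n"
    by (intro mult_left_mono power_mono) (auto simp: C_def)
  finally have 2: "2 ^ (3 * s + 2) * (1 / 2 ^ 40) ^ (s - 1) \<le> C * (1 / 2) ^ n" .
  have "36 / 2 ^ 16 * (1 / 2) ^ n + C * (1 / 2) ^ n = (36 / 2 ^ 16 + C) * (1 / 2) ^ n"
    by (simp add: distrib_right)
  also have "\<dots> \<le> (1 / 2 ^ 10) * (1 / 2) ^ n"
    by (intro mult_right_mono) (simp_all add: C_def power_one_over)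
  also have "\<dots> = 1 / 2 ^ (s + 2)" by (simp add: s power_add power_one_over)
  finally show ?thesis using 1 2 by linarith
qed

text \<open>For bias 2^(-l) the left side adds the cost of the error sets and the cost of the factor
  (1 + 2 * 2^(-l))^K. Both decay faster than (9/10)^l, and l = 4 is the first value at which half of
  that saving covers them.\<close>

lemma exponent_bias_bound:
  fixes l :: nat
  assumes "4 \<le> l"
  shows "24 * real l / 8 ^ l + 4 / 2 ^ l \<le> (9 / 10) ^ l / (2 :: real)"
proof -
  obtain n where l: "l = n + 4" using assms le_Suc_ex by (metis add.commute)
  have n: "real n + 1 \<le> 2 ^ n" by (induction n) auto
  have "24 * (real n + 4) / 8 ^ l \<le> 96 * 2 ^ n / 8 ^ l"
    using n by (intro divide_right_mono) auto
  also have "\<dots> = 96 / 4096 * (1 / 4) ^ n"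
  proof -
    have "(8::real) ^ l = 4096 * (2 ^ n * 4 ^ n)"
      by (simp add: l power_add power_mult_distrib[symmetric])
    then show ?thesis by (simp add: power_one_over)
  qed
  also have "\<dots> \<le> 96 / 4096 * (9 / 10) ^ n" by (intro mult_left_mono power_mono) auto
  finally have 1: "24 * real l / 8 ^ l \<le> 96 / 4096 * (9 / 10) ^ n" by (simp add: l)
  have "4 / 2 ^ l = 1 / 4 * (1 / 2 :: real) ^ n" by (simp add: l power_add power_one_over)
  also have "\<dots> \<le> 1 / 4 * (9 / 10) ^ n" by (intro mult_left_mono power_mono) auto
  finally have 2: "4 / 2 ^ l \<le> 1 / 4 * (9 / 10 :: real) ^ n" .
  have "96 / 4096 * (9 / 10) ^ n + 1 / 4 * (9 / 10) ^ n \<le> 6561 / 20000 * (9 / 10 :: real) ^ n"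
    by (simp add: distrib_right[symmetric])
  also have "\<dots> = (9 / 10) ^ l / 2" by (simp add: l power_add power_divide)
  finally show ?thesis using 1 2 by linarith
qed

context
  fixes m r K :: nat
  assumes m: "0 < m" and rm: "2 ^ 40 * r \<le> m" and KR: "K \<le> binom_le m r"
begin

lemma ratio: "real r / m \<le> 1 / 2 ^ 40" "r \<le> m" "2 * r \<le> m"
proof -
  have "real (2 ^ 40 * r) \<le> m" using rm unfolding of_nat_le_iff .
  then show "real r / m \<le> 1 / 2 ^ 40" using m by (simp add: field_simps)
  show "r \<le> m" "2 * r \<le> m" using rm by auto
qed

lemma layer_low_weight:
  fixes lo :: real
  assumes "8 \<le> s" "3 * s + 2 \<le> m" "0 \<le> lo" "lo \<le> 1"
  shows "layer m r K lo (1 / 2 ^ s)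
     \<le> 2 * 2 powr (binom_le m r * (1 / 2 ^ (s + 2)) - binom_le m r + K - lo * K)"
proof -
  define R where "R = real (binom_le m r)"
  define c where "c = 2 ^ (3 * s + 2) * (1 / 2 ^ 40) ^ (s - 1) * R"
  have "layer m r K lo (1 / 2 ^ s) \<le> 2 * 2 powr (c + R * (2 * (real (2 * s) + 2) / 2 ^ (2 * s)) - R + K) * (1 - lo) ^ K"
    unfolding R_def
  \<comment> \<open>With k = s - 1 the threshold 2^(-k) is twice the largest weight, so the margin
    is 2^(-s) and the Chebyshev ratio is 2^(s-t) = 2^(-(2s+2)).\<close>
  proof (rule layer_le[of "3 * s + 2" m "s - 1"])
    obtain n where s: "s = Suc n" using assms(1) by (cases s) auto
    show "1 / 2 ^ s < (1 / 2 ^ (s - 1) :: real)" by (simp add: s field_simps)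
    have "1 / 2 ^ (s - 1) - 1 / 2 ^ s = (1 / 2 ^ s :: real)" by (simp add: s)
    then have "1 / 2 ^ s / (2 ^ (3 * s + 2) * (1 / 2 ^ (s - 1) - 1 / 2 ^ s)\<^sup>2)
        = 1 / 2 ^ s / (2 ^ (3 * s + 2) * (1 / 2 ^ s)\<^sup>2 :: real)" by simp
    also have "\<dots> = 1 / 2 ^ (2 * s + 2)"
      by (simp add: power2_eq_square field_simps power_add[symmetric])
    also have "\<dots> \<le> 1 / 2 ^ Suc (2 * s)" by (simp add: field_simps)
    finally show "1 / 2 ^ s / (2 ^ (3 * s + 2) * (1 / 2 ^ (s - 1) - 1 / 2 ^ s)\<^sup>2) \<le> (1 / 2 ^ Suc (2 * s) :: real)" .
    have "real (card {S \<in> mons m r. s - 1 \<le> card (S \<inter> {..<3 * s + 2})}) \<le> 2 ^ (3 * s + 2) * (r / m) ^ (s - 1) * R"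
      unfolding R_def using assms(2) ratio by (intro card_mons_meeting_block)
    also have "\<dots> \<le> c" unfolding c_def R_def
      using ratio by (intro mult_right_mono mult_left_mono power_mono) auto
    finally show "real (card {S \<in> mons m r. s - 1 \<le> card (S \<inter> {..<3 * s + 2})}) \<le> c" .
  qed (use assms in auto)
  also have "\<dots> \<le> 2 * 2 powr (R * (1 / 2 ^ (s + 2)) - R + K) * 2 powr (- (lo * K))"
  proof (intro mult_mono mult_left_mono powr_mono one_minus_power_le_powr)
    have "R * (2 * (real (2 * s) + 2) / 2 ^ (2 * s) + 2 ^ (3 * s + 2) * (1 / 2 ^ 40) ^ (s - 1)) \<le> R * (1 / 2 ^ (s + 2))"
      using exponent_low_weight_bound[OF assms(1)] by (intro mult_left_mono) (auto simp: R_def)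
    then show "c + R * (2 * (real (2 * s) + 2) / 2 ^ (2 * s)) - R + K \<le> R * (1 / 2 ^ (s + 2)) - R + K"
      by (simp only: c_def distrib_left mult.commute[of R])
  qed (use assms in auto)
  also have "\<dots> = 2 * 2 powr (R * (1 / 2 ^ (s + 2)) - R + K - lo * K)"
    by (simp add: powr_add[symmetric])
  finally show ?thesis unfolding R_def .
qed

lemma layer_middle:
  assumes "24 \<le> m"
  shows "layer m r K (1 / 2 ^ 8) (7 / 16) \<le> 2 * 2 powr (- (binom_le m r / 512))"
proof -
  define R where "R = real (binom_le m r)"
  have R: "0 \<le> R" "K \<le> R" using KR by (auto simp: R_def)
  define c where "c = 2 ^ 24 * (1 / 2 ^ 40) ^ 1 * R"
  have "layer m r K (1 / 2 ^ 8) (7 / 16) \<le> 2 * 2 powr (c + R * (2 * (real 16 + 2) / 2 ^ 16) - R + K) * (1 - 1 / 2 ^ 8) ^ K"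
    unfolding R_def
  \<comment> \<open>The margin to 1/2 is 1/16, so t = 24 gives the ratio 112 / 2^24 < 2^(-17), hence
    j = 16.\<close>
  proof (rule layer_le[of 24 m 1])
    have "real (card {S \<in> mons m r. 1 \<le> card (S \<inter> {..<24})}) \<le> 2 ^ 24 * (r / m) ^ 1 * R"
      unfolding R_def using assms ratio by (intro card_mons_meeting_block)
    also have "\<dots> \<le> c" unfolding c_def R_def
      using ratio by (intro mult_right_mono mult_left_mono power_mono) auto
    finally show "real (card {S \<in> mons m r. 1 \<le> card (S \<inter> {..<24})}) \<le> c" .
  qed (use assms in \<open>auto simp: power2_eq_square\<close>)
  also have "\<dots> \<le> 2 * 2 powr (c + R * (2 * (real 16 + 2) / 2 ^ 16) - R + K) * 2 powr (- (1 / 2 ^ 8 * K))"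
    by (intro mult_left_mono one_minus_power_le_powr) auto
  also have "\<dots> = 2 * 2 powr (c + R * (2 * (real 16 + 2) / 2 ^ 16) - R + K - 1 / 2 ^ 8 * K)"
    by (simp add: powr_add[symmetric])
  \<comment> \<open>High monomials cost 2^(-16) R and errors 36 * 2^(-16) R, while weight at least
    2^(-8) saves 2^(-8) K. Since K enters with a positive coefficient it may be replaced by R, and
    37/2^16 - 1/2^8 < -1/512.\<close>
  also have "\<dots> \<le> 2 * 2 powr (- (R / 512))"
    using R by (intro mult_left_mono powr_mono) (auto simp: c_def)
  finally show ?thesis unfolding R_def .
qed

lemma layer_bias:
  assumes "4 \<le> l" "10 * l \<le> m"
  shows "layer m r K ((1 - 2 / 2 ^ l) / 2) ((1 - 1 / 2 ^ l) / 2) \<le> 2 * 2 powr (- (binom_le m r * (9 / 10) ^ l / 2))"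
proof -
  define R where "R = real (binom_le m r)"
  have R: "0 \<le> R" "K \<le> R" using KR by (auto simp: R_def)
  define b :: real where "b = 1 / 2 ^ l"
  have "b \<le> 1 / 2 ^ 4" unfolding b_def using assms(1) by (intro divide_left_mono power_increasing) auto
  then have b: "0 < b" "b \<le> 1 / 16" by (auto simp: b_def)
  define c where "c = (1 - (9 / 10) ^ l) * R"
  have "layer m r K ((1 - 2 * b) / 2) ((1 - b) / 2)
      \<le> 2 * 2 powr (c + R * (2 * (real (3 * l - 2) + 2) / 2 ^ (3 * l - 2)) - R + K) * (1 - (1 - 2 * b) / 2) ^ K"
    unfolding R_def
  \<comment> \<open>The margin to 1/2 is b/2 with b = 2^(-l), and t = 5l brings the Chebyshev ratio
    down to 2 / 2^(3l), hence j = 3l - 2. At the same time (1 - 2r/m)^5 >= 9/10 keeps a fraction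
    (9/10)^l of the monomials off the block.\<close>
  proof (rule layer_le[of "5 * l" m 1])
    have e: "1 / 2 ^ 1 - (1 - b) / 2 = b / 2" by (simp add: field_simps)
    have "(1 - b) / 2 / (2 ^ (5 * l) * (1 / 2 ^ 1 - (1 - b) / 2)\<^sup>2) = (1 - b) / 2 / (2 ^ (5 * l) * (b / 2)\<^sup>2)"
      by (simp only: e)
    also have "\<dots> \<le> 1 / 2 / (2 ^ (5 * l) * (b / 2)\<^sup>2)"
      using b by (intro divide_right_mono) auto
    also have "\<dots> = 2 / 2 ^ (3 * l)"
    proof -
      have "(2::real) ^ (5 * l) = 2 ^ (3 * l) * (2 ^ l * 2 ^ l)"
        by (simp only: power_add[symmetric]) simp
      then show ?thesis by (simp add: b_def power2_eq_square)
    qed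
    also have "\<dots> = 1 / 2 ^ Suc (3 * l - 2)"
    proof -
      have "3 * l = Suc (Suc (3 * l - 2))" using assms(1) by simp
      then have "(2::real) ^ (3 * l) = 2 * 2 ^ Suc (3 * l - 2)" by (metis power_Suc)
      then show ?thesis by simp
    qed
    finally show "(1 - b) / 2 / (2 ^ (5 * l) * (1 / 2 ^ 1 - (1 - b) / 2)\<^sup>2) \<le> 1 / 2 ^ Suc (3 * l - 2)" .
    have "real (card {S \<in> mons m r. 1 \<le> card (S \<inter> {..<5 * l})}) \<le> (1 - (1 - 2 * real r / m) ^ (5 * l)) * R"
      unfolding R_def using assms(2) ratio m by (intro card_mons_meeting_block_one) auto
    also have "\<dots> \<le> c" unfolding c_def
    proof (rule mult_right_mono)
      have x: "99 / 100 \<le> 1 - 2 * real r / m"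
        using mult_left_mono[OF ratio(1), of 2] by simp
      have "(9 / 10 :: real) \<le> (99 / 100) ^ 5" by (simp add: power_divide)
      also have "\<dots> \<le> (1 - 2 * real r / m) ^ 5" using x by (intro power_mono) auto
      finally have "(9 / 10) ^ l \<le> ((1 - 2 * real r / m) ^ 5) ^ l" by (rule power_mono) simp
      then show "1 - (1 - 2 * real r / m) ^ (5 * l) \<le> 1 - (9 / 10) ^ l" by (simp add: power_mult)
    qed (use R in simp)
    finally show "real (card {S \<in> mons m r. 1 \<le> card (S \<inter> {..<5 * l})}) \<le> c" .
  qed (use assms b in auto)
  \<comment> \<open>The factor 2^(-K) of ((1 + 2b)/2)^K cancels the normalising 2^K, leaving only (1
    + 2b)^K.\<close>
  also have "\<dots> = 2 * 2 powr (c + R * (24 * l / 8 ^ l) - R) * (1 + 2 * b) ^ K"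
  proof -
    have "3 * l = 3 * l - 2 + 2" using assms(1) by simp
    then have "(2::real) ^ (3 * l) = 2 ^ (3 * l - 2) * 2 ^ 2" by (simp only: power_add[symmetric])
    then have e1: "2 * (real (3 * l - 2) + 2) / 2 ^ (3 * l - 2) = 24 * l / 8 ^ l"
      using assms(1) by (simp add: of_nat_diff power_mult)
    have e2: "1 - (1 - 2 * b) / 2 = (1 + 2 * b) / 2" by (simp add: field_simps)
    show ?thesis unfolding e1 e2 by (simp add: powr_add powr_realpow power_divide)
  qed
  also have "\<dots> \<le> 2 * 2 powr (c + R * (24 * l / 8 ^ l) - R) * 2 powr (2 * (2 * b) * K)"
    using b by (intro mult_left_mono one_plus_power_le_powr) auto
  also have "\<dots> = 2 * 2 powr (c + R * (24 * l / 8 ^ l) - R + 4 * b * K)"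
    by (simp add: powr_add[symmetric])
  also have "\<dots> \<le> 2 * 2 powr (- (R * (9 / 10) ^ l / 2))"
  proof (intro mult_left_mono powr_mono)
    have "4 * b * K \<le> R * (4 * b)" using R b by (simp add: mult_left_mono)
    then have "c + R * (24 * l / 8 ^ l) - R + 4 * b * K \<le> R * ((24 * l / 8 ^ l + 4 * b) - (9 / 10) ^ l)"
      unfolding c_def by (simp add: algebra_simps)
    also have "\<dots> \<le> R * (- ((9 / 10) ^ l / 2))"
      using exponent_bias_bound[OF assms(1)] R by (intro mult_left_mono) (auto simp: b_def)
    finally show "c + R * (24 * l / 8 ^ l) - R + 4 * b * K \<le> - (R * (9 / 10) ^ l / 2)" by simp
  qed auto
  finally show ?thesis unfolding R_def b_def by simp
qed

end

lemma layer_unbiased: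
  assumes "0 \<le> b"
  shows "layer m r K ((1 - b) / 2) 1 \<le> exp (b * K)"
proof -
  define A where "A = {P \<in> Pow (mons m r). (1 - b) / 2 \<le> weight m P / 2 ^ m \<and> weight m P / 2 ^ m \<le> 1}"
  have "layer m r K ((1 - b) / 2) 1 \<le> (\<Sum>P\<in>A. 2 ^ K / 2 ^ binom_le m r * ((1 + b) / 2) ^ K)"
    unfolding layer_def A_def[symmetric]
    by (intro sum_mono mult_left_mono power_mono) (auto simp: A_def field_simps)
  also have "\<dots> = card A * (2 ^ K / 2 ^ binom_le m r * ((1 + b) / 2) ^ K)" by simp
  also have "\<dots> \<le> 2 ^ binom_le m r * (2 ^ K / 2 ^ binom_le m r * ((1 + b) / 2) ^ K)"
  proof (rule mult_right_mono)
    have "card A \<le> card (Pow (mons m r))" by (rule card_mono) (auto simp: A_def)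
    then have "card A \<le> 2 ^ binom_le m r" by (simp add: card_Pow card_mons)
    then have "real (card A) \<le> real (2 ^ binom_le m r)" unfolding of_nat_le_iff .
    then show "real (card A) \<le> 2 ^ binom_le m r" by simp
  qed (use assms in simp)
  also have "\<dots> = (1 + b) ^ K" by (simp add: power_divide)
  also have "\<dots> \<le> exp b ^ K" using assms exp_ge_add_one_self[of b] by (intro power_mono) auto
  also have "\<dots> = exp (b * K)" by (simp add: exp_of_nat_mult[symmetric] mult.commute)
  finally show ?thesis .
qed

context
  fixes m r K :: nat
  assumes m: "0 < m" and rm: "2 ^ 40 * r \<le> m" and KR: "K \<le> binom_le m r"
begin

text \<open>Dyadic decomposition of [2^(-s1), 2^(-8)]: on each piece the saving 2^(-(s+1)) R beats
  the count 2^(-(s+2)) R. On [0, 2^(-s1)] the slack \<epsilon> R >= 2^(-(s1+1)) R takes the place of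
  that saving.\<close>

lemma layer_below_eighth:
  fixes \<epsilon> :: real
  assumes s1: "8 \<le> s1" "3 * s1 + 2 \<le> m" and \<epsilon>: "1 / 2 ^ (s1 + 1) \<le> \<epsilon>" "K \<le> (1 - \<epsilon>) * binom_le m r"
  shows "layer m r K 0 (1 / 2 ^ 8) \<le> (real s1 + 1) * (2 * 2 powr (- (binom_le m r / 2 ^ (s1 + 2))))"
proof -
  define R where "R = real (binom_le m r)"
  define B where "B = 2 * 2 powr (- (R / 2 ^ (s1 + 2)))"
  have R: "0 \<le> R" "K \<le> R" using KR by (auto simp: R_def)
  have dyadic: "layer m r K (1 / 2 ^ (s + 1)) (1 / 2 ^ s) \<le> B" if s: "8 \<le> s" "s < s1" for s
  proof -
    define x :: real where "x = 1 / 2 ^ (s + 1)"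
    have x: "0 \<le> x" "x \<le> 1"
      using power_le_one[of "1 / 2 :: real" "s + 1"] by (simp_all add: x_def power_one_over)
    have "layer m r K x (1 / 2 ^ s) \<le> 2 * 2 powr (R * (1 / 2 ^ (s + 2)) - R + K - x * K)"
      unfolding R_def by (rule layer_low_weight[OF m rm KR]) (use s s1 x in auto)
    also have "\<dots> \<le> B" unfolding B_def
    proof (intro mult_left_mono powr_mono)
      have "(1 - x) * K \<le> (1 - x) * R" using x R by (intro mult_left_mono) auto
      \<comment> \<open>Since x <= 1, K <= R turns -R + K - xK into at most -xR.\<close>
      then have "R * (1 / 2 ^ (s + 2)) - R + K - x * K \<le> R * (1 / 2 ^ (s + 2)) - R * x"
        by (simp add: algebra_simps)
      also have "\<dots> = - (R / 2 ^ (s + 2))" by (simp add: x_def field_simps)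
      also have "\<dots> \<le> - (R / 2 ^ (s1 + 2))"
        using s R by (simp add: divide_left_mono power_increasing)
      finally show "R * (1 / 2 ^ (s + 2)) - R + K - x * K \<le> - (R / 2 ^ (s1 + 2))" .
    qed auto
    finally show ?thesis unfolding x_def .
  qed
  have "s \<le> s1 \<Longrightarrow> layer m r K 0 (1 / 2 ^ 8) \<le> layer m r K 0 (1 / 2 ^ s) + real s * B" if "8 \<le> s" for s
    using that
  proof (induction s rule: dec_induct)
    case base
    then show ?case by (simp add: B_def)
  next
    case (step s)
    have "layer m r K 0 (1 / 2 ^ 8) \<le> layer m r K 0 (1 / 2 ^ s) + real s * B" using step by simp
    also have "layer m r K 0 (1 / 2 ^ s) \<le> layer m r K 0 (1 / 2 ^ (s + 1)) + layer m r K (1 / 2 ^ (s + 1)) (1 / 2 ^ s)"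
      by (rule layer_split)
    also have "layer m r K (1 / 2 ^ (s + 1)) (1 / 2 ^ s) \<le> B" using step by (intro dyadic) auto
    finally show ?case by (simp add: distrib_right)
  qed
  from this[OF s1(1)] have "layer m r K 0 (1 / 2 ^ 8) \<le> layer m r K 0 (1 / 2 ^ s1) + real s1 * B" by simp
  also have "layer m r K 0 (1 / 2 ^ s1) \<le> 2 * 2 powr (R * (1 / 2 ^ (s1 + 2)) - R + K - 0 * real K)"
    unfolding R_def by (rule layer_low_weight[OF m rm KR]) (use s1 in auto)
  also have "\<dots> \<le> B" unfolding B_def
  proof (intro mult_left_mono powr_mono)
    have "R * (1 / 2 ^ (s1 + 1)) \<le> R * \<epsilon>" using \<epsilon>(1) R by (intro mult_left_mono) auto
    then have "R * (1 / 2 ^ (s1 + 2)) - R + K - 0 * real K \<le> R * (1 / 2 ^ (s1 + 2)) - R * (1 / 2 ^ (s1 + 1))"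
      using \<epsilon>(2) by (simp add: R_def algebra_simps)
    also have "\<dots> = - (R / 2 ^ (s1 + 2))" by (simp add: field_simps)
    finally show "R * (1 / 2 ^ (s1 + 2)) - R + K - 0 * real K \<le> - (R / 2 ^ (s1 + 2))" .
  qed auto
  finally show ?thesis unfolding B_def R_def by (simp add: distrib_right)
qed

text \<open>Biases are cut at 2^(-l) for l from 4, where the weight is 7/16, up to L with 2^L about
  R^2. Logarithmically many scales keep (9/10)^l R at least of order sqrt R, while the remaining
  bias 2^(-L) already makes the trivial bound exp(1/R).\<close>

lemma layer_above_seven_sixteenths:
  assumes m20: "20 \<le> m" and R4: "4 \<le> binom_le m r"
  shows "layer m r K (7 / 16) 1
    \<le> 2 * (binom_le m r)\<^sup>2 * (2 * 2 powr (- (sqrt (binom_le m r) / 4))) + exp (1 / binom_le m r)"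
proof -
  define R where "R = real (binom_le m r)"
  have R: "4 \<le> R" "K \<le> R" using KR R4 by (auto simp: R_def)
  define D where "D = 2 * 2 powr (- (sqrt R / 4))"
  obtain n where n: "2 ^ n \<le> (binom_le m r)\<^sup>2" "(binom_le m r)\<^sup>2 < 2 ^ (n + 1)"
    using ex_power_ivl1[of 2 "(binom_le m r)\<^sup>2"] R4 by auto
  \<comment> \<open>This gives R^2 <= 2^L <= 2 R^2: the lower bound serves the trivial estimate at
    the end, the upper one the savings at each scale.\<close>
  define L where "L = n + 1"
  have "real ((binom_le m r)\<^sup>2) \<le> real (2 ^ L)" unfolding of_nat_le_iff L_def using n by simp
  then have L1: "R\<^sup>2 \<le> 2 ^ L" by (simp add: R_def)
  have "real (2 ^ L) \<le> real (2 * (binom_le m r)\<^sup>2)" unfolding of_nat_le_iff L_def using n by simp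
  then have L2: "2 ^ L \<le> 2 * R\<^sup>2" by (simp add: R_def)
  have L4: "4 \<le> L"
  proof (rule ccontr)
    assume "\<not> 4 \<le> L"
    then have "(2::real) ^ L \<le> 2 ^ 3" by (intro power_increasing) auto
    moreover have "4\<^sup>2 \<le> R\<^sup>2" using R by (intro power_mono) auto
    ultimately show False using L1 by simp
  qed
  \<comment> \<open>R <= 2^(m/40) yields L <= 1 + m/20, which is at most m/10 once m >= 20.\<close>
  have Lm: "10 * L \<le> m"
  proof -
    have "2 powr L \<le> 2 * R\<^sup>2" using L2 by (simp add: powr_realpow)
    also have "\<dots> \<le> 2 powr 1 * (2 powr (m / 40))\<^sup>2"
      using binom_le_small[OF rm] by (simp add: R_def power_mono)
    also have "\<dots> = 2 powr (1 + m / 20)"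
      unfolding powr_power_two powr_add[symmetric] by simp
    finally have "L \<le> 1 + m / 20" by simp
    then show ?thesis using m20 by simp
  qed
  have bias: "layer m r K ((1 - 2 / 2 ^ l) / 2) ((1 - 1 / 2 ^ l) / 2) \<le> D" if l: "4 \<le> l" "l \<le> L" for l
  proof -
    have "layer m r K ((1 - 2 / 2 ^ l) / 2) ((1 - 1 / 2 ^ l) / 2) \<le> 2 * 2 powr (- (R * (9 / 10) ^ l / 2))"
      unfolding R_def by (rule layer_bias[OF m rm KR]) (use l Lm in auto)
    also have "\<dots> \<le> D" unfolding D_def
    proof (intro mult_left_mono powr_mono)
      \<comment> \<open>Compare fourth powers: (9/10)^4 >= 1/2, so the right side becomes at least
        2^(-l), and 2^l <= 2 R^2 <= 16 R^2.\<close>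
      have "1 / (2 * sqrt R) \<le> (9 / 10) ^ l"
      proof (rule power_le_imp_le_base)
        have "(2 * sqrt R) ^ Suc 3 = 16 * R\<^sup>2"
        proof -
          have "(2 * sqrt R) ^ Suc 3 = ((2 * sqrt R)\<^sup>2)\<^sup>2" by (subst power_mult[symmetric]) simp
          also have "(2 * sqrt R)\<^sup>2 = 4 * R" using R by (simp add: power_mult_distrib)
          finally show ?thesis by (simp add: power_mult_distrib)
        qed
        then have "(1 / (2 * sqrt R)) ^ Suc 3 = 1 / (16 * R\<^sup>2)" by (simp only: power_one_over)
        also have "\<dots> \<le> 1 / 2 ^ l"
        proof (rule divide_left_mono)
          have "(2::real) ^ l \<le> 2 ^ L" using l by (intro power_increasing) auto
          also have "\<dots> \<le> 16 * R\<^sup>2" using L2 zero_le_power2[of R] by linarith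
          finally show "2 ^ l \<le> 16 * R\<^sup>2" .
        qed (use R in auto)
        also have "\<dots> = (1 / 2) ^ l" by (simp add: power_one_over)
        also have "\<dots> \<le> ((9 / 10) ^ Suc 3) ^ l" by (intro power_mono) (auto simp: power_divide)
        also have "\<dots> = ((9 / 10) ^ l) ^ Suc 3" by (simp only: power_mult[symmetric] mult.commute)
        finally show "(1 / (2 * sqrt R)) ^ Suc 3 \<le> ((9 / 10) ^ l) ^ Suc 3" .
      qed simp
      then have "R * (1 / (2 * sqrt R)) \<le> R * (9 / 10) ^ l" using R by (intro mult_left_mono) auto
      moreover have "R * (1 / (2 * sqrt R)) = sqrt R / 2" using R real_div_sqrt[of R] by simp
      ultimately show "- (R * (9 / 10) ^ l / 2) \<le> - (sqrt R / 4)" by simp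
    qed auto
    finally show ?thesis .
  qed
  \<comment> \<open>Cut points of the weight range: \<open>e 4\<close> is 7/16, and
    \<open>e (Suc L)\<close> is the weight of bias 2^(-L), where the trivial bound takes
    over.\<close>
  define e :: "nat \<Rightarrow> real" where "e l = (1 - 2 / 2 ^ l) / 2" for l
  have e_Suc: "e (Suc l) = (1 - 1 / 2 ^ l) / 2" for l by (simp add: e_def)
  have "l \<le> Suc L \<Longrightarrow> layer m r K (e 4) 1 \<le> layer m r K (e l) 1 + real (l - 1) * D" if "4 \<le> l" for l
    using that
  proof (induction l rule: dec_induct)
    case base
    then show ?case by (simp add: D_def)
  next
    case (step l)
    have "layer m r K (e 4) 1 \<le> layer m r K (e l) 1 + real (l - 1) * D" using step by simp
    also have "layer m r K (e l) 1 \<le> layer m r K (e l) (e (Suc l)) + layer m r K (e (Suc l)) 1"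
      by (rule layer_split)
    also have "layer m r K (e l) (e (Suc l)) \<le> D"
      unfolding e_Suc unfolding e_def using step by (intro bias) auto
    also have "D + layer m r K (e (Suc l)) 1 + real (l - 1) * D = layer m r K (e (Suc l)) 1 + real (Suc l - 1) * D"
      using step by (simp add: of_nat_diff algebra_simps)
    finally show ?case by simp
  qed
  from this[of "Suc L"] have "layer m r K (e 4) 1 \<le> layer m r K (e (Suc L)) 1 + real L * D"
    using L4 by simp
  also have "layer m r K (e (Suc L)) 1 \<le> exp (1 / 2 ^ L * K)"
    unfolding e_Suc by (rule layer_unbiased) simp
  also have "\<dots> \<le> exp (1 / R)"
  proof -
    have "1 / 2 ^ L * K \<le> 1 / R\<^sup>2 * R"
      using L1 R by (intro mult_mono divide_left_mono) auto
    also have "\<dots> = 1 / R" using R by (simp add: power2_eq_square)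
    finally show ?thesis by simp
  qed
  also have "real L * D \<le> 2 * R\<^sup>2 * D"
  proof (rule mult_right_mono)
    have "real L \<le> 2 ^ L" using of_nat_less_two_power[of L, where ?'a = real] by simp
    then show "real L \<le> 2 * R\<^sup>2" using L2 by linarith
  qed (simp add: D_def)
  finally show ?thesis by (simp add: e_def D_def R_def)
qed

end

section \<open>Assembly of the layers and passage to the limit\<close>

definition failure_bound :: "nat \<Rightarrow> real \<Rightarrow> real" where
  "failure_bound s x = (real s + 1) * (2 * 2 powr (- (x / 2 ^ (s + 2)))) + 2 * 2 powr (- (x / 512))
     + 2 * x\<^sup>2 * (2 * 2 powr (- (sqrt x / 4))) + exp (1 / x)"

lemma recovery_prob_ge_failure_bound:
  fixes \<epsilon> :: real
  assumes "0 < m" "2 ^ 40 * r \<le> m" "d + r < m" "8 \<le> s" "3 * s + 2 \<le> m" "1 / 2 ^ (s + 1) \<le> \<epsilon>"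
    and "K \<le> (1 - \<epsilon>) * binom_le m r" "4 \<le> binom_le m r"
  shows "recovery_prob m d K \<ge> 2 - failure_bound s (binom_le m r)"
proof -
  have "0 \<le> \<epsilon>" using assms(6) by (rule order_trans[rotated]) simp
  then have "(1 - \<epsilon>) * binom_le m r \<le> 1 * real (binom_le m r)" by (intro mult_right_mono) auto
  then have "real K \<le> binom_le m r" using assms(7) by simp
  then have KR: "K \<le> binom_le m r" by simp
  have "card (mons m r) \<le> card (points m)" by (intro card_mono mons_subset_points) simp
  then have K2: "K \<le> 2 ^ m" using KR by (simp add: card_mons card_points)
  note ctx = assms(1,2) KR
  have "2 ^ K / 2 ^ card (mons m r) * (\<Sum>P\<in>Pow (mons m r). (1 - weight m P / 2 ^ m) ^ K) = layer m r K 0 1"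
  proof -
    have "{P \<in> Pow (mons m r). 0 \<le> weight m P / 2 ^ m \<and> weight m P / 2 ^ m \<le> (1 :: real)} = Pow (mons m r)"
      using weight_frac_le_one by auto
    then show ?thesis unfolding layer_def card_mons sum_distrib_left by (intro sum.cong) simp_all
  qed
  also have "\<dots> \<le> layer m r K 0 (1 / 2 ^ 8) + layer m r K (1 / 2 ^ 8) 1" by (rule layer_split)
  also have "layer m r K (1 / 2 ^ 8) 1 \<le> layer m r K (1 / 2 ^ 8) (7 / 16) + layer m r K (7 / 16) 1"
    by (rule layer_split)
  also have "layer m r K 0 (1 / 2 ^ 8) \<le> (real s + 1) * (2 * 2 powr (- (binom_le m r / 2 ^ (s + 2))))"
    by (rule layer_below_eighth[OF ctx assms(4-7)])
  also have "layer m r K (1 / 2 ^ 8) (7 / 16) \<le> 2 * 2 powr (- (binom_le m r / 512))"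
    using assms(4,5) by (intro layer_middle[OF ctx]) auto
  also have "layer m r K (7 / 16) 1
      \<le> 2 * (binom_le m r)\<^sup>2 * (2 * 2 powr (- (sqrt (binom_le m r) / 4))) + exp (1 / binom_le m r)"
    using assms(4,5,8) by (intro layer_above_seven_sixteenths[OF ctx]) auto
  finally have "2 ^ K / 2 ^ card (mons m r) * (\<Sum>P\<in>Pow (mons m r). (1 - weight m P / 2 ^ m) ^ K)
      \<le> failure_bound s (binom_le m r)"
    by (simp add: failure_bound_def)
  then show ?thesis using recovery_prob_ge[OF assms(3) K2] by linarith
qed

text \<open>The limit is 1 because the nearly balanced polynomials contribute exp(1/x); every other
  term decays exponentially in x or in sqrt x. Here s is fixed, depending only on
  \<epsilon>.\<close>

lemma failure_bound_tendsto: "(failure_bound s \<longlongrightarrow> 1) at_top"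
proof -
  define c :: real where "c = 1 / 2 ^ (s + 2)"
  have "c > 0" by (simp add: c_def)
  then have "((\<lambda>x. 2 * 2 powr (- (x * c))) \<longlongrightarrow> 0) at_top" by real_asymp
  then have "((\<lambda>x. (real s + 1) * (2 * 2 powr (- (x * c)))) \<longlongrightarrow> 0) at_top"
    by (rule tendsto_mult_right_zero)
  moreover have "((\<lambda>x::real. 2 * 2 powr (- (x / 512)) + 2 * x\<^sup>2 * (2 * 2 powr (- (sqrt x / 4))) + exp (1 / x))
      \<longlongrightarrow> 1) at_top"
    by real_asymp
  ultimately have "((\<lambda>x. (real s + 1) * (2 * 2 powr (- (x * c))) + (2 * 2 powr (- (x / 512))
     + 2 * x\<^sup>2 * (2 * 2 powr (- (sqrt x / 4))) + exp (1 / x))) \<longlongrightarrow> 0 + 1) at_top"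
    by (rule tendsto_add)
  then show ?thesis by (simp add: failure_bound_def[abs_def] c_def add.assoc)
qed

theorem theorem1p2:
  shows "\<exists>\<gamma>0::real. \<gamma>0 > 0 \<and>
    (\<forall>\<epsilon>::real. 0 < \<epsilon> \<and> \<epsilon> < 1 \<longrightarrow>
      (\<forall>\<delta>::real. \<delta> > 0 \<longrightarrow>
        (\<exists>N::nat. \<forall>m d::nat.
           real d > real m * (1 - \<gamma>0) \<and> d < m \<and> m - d \<ge> N \<longrightarrow>
           recovery_prob m d (nat \<lfloor>(1 - \<epsilon>) * real (binom_le m (m - d - 1))\<rfloor>)
             \<ge> 1 - \<delta>)))"
proof (intro exI[of _ "1 / 2 ^ 40"] conjI allI impI)
  fix \<epsilon> \<delta> :: real
  assume \<epsilon>: "0 < \<epsilon> \<and> \<epsilon> < 1" and \<delta>: "0 < \<delta>"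
  \<comment> \<open>2^(-s0) is the scale below which \<epsilon> pays for the low weights; adding 8
    meets the requirement s >= 8 of the dyadic layers.\<close>
  obtain s0 where s0: "(1 / 2) ^ s0 < \<epsilon>" using \<epsilon> real_arch_pow_inv[of \<epsilon> "1 / 2"] by auto
  define s where "s = s0 + 8"
  have s: "1 / 2 ^ (s + 1) \<le> \<epsilon>"
  proof -
    have "(1 / 2 :: real) ^ (s + 1) \<le> (1 / 2) ^ s0" by (rule power_decreasing) (auto simp: s_def)
    then show ?thesis using s0 by (simp add: power_one_over)
  qed
  have "eventually (\<lambda>x. failure_bound s x < 1 + \<delta>) at_top"
    using order_tendstoD(2)[OF failure_bound_tendsto[of s], of "1 + \<delta>"] \<delta> by simp
  then obtain x0 where x0: "\<And>x. x \<ge> x0 \<Longrightarrow> failure_bound s x < 1 + \<delta>"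
    unfolding eventually_at_top_linorder by blast
  \<comment> \<open>From N <= m - d follow r >= 1, 3s + 2 <= m and, because the degree-one monomials
    give m <= R, also x0 <= R and 4 <= R.\<close>
  define N where "N = nat \<lceil>x0\<rceil> + 3 * s + 2"
  show "\<exists>N. \<forall>m d. real m * (1 - 1 / 2 ^ 40) < real d \<and> d < m \<and> N \<le> m - d \<longrightarrow>
      1 - \<delta> \<le> recovery_prob m d (nat \<lfloor>(1 - \<epsilon>) * real (binom_le m (m - d - 1))\<rfloor>)"
  proof (intro exI[of _ N] allI impI)
    fix m d :: nat
    assume md: "real m * (1 - 1 / 2 ^ 40) < real d \<and> d < m \<and> N \<le> m - d"
    define r where "r = m - d - 1"
    define K where "K = nat \<lfloor>(1 - \<epsilon>) * real (binom_le m r)\<rfloor>"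
    have dr: "d + r < m" "r < m - d" using md by (auto simp: r_def)
    have "1 \<le> r" using md by (auto simp: r_def N_def)
    have "real (2 ^ 40 * r) \<le> m"
    proof -
      have "real r \<le> real m - d" using dr by linarith
      also have "\<dots> \<le> m / 2 ^ 40" using md by (simp add: algebra_simps)
      finally show ?thesis by simp
    qed
    then have rm: "2 ^ 40 * r \<le> m" unfolding of_nat_le_iff .
    have "N \<le> m - d" using md by blast
    then have Nm: "N \<le> m" by simp
    have "m choose 1 \<le> binom_le m r"
      unfolding binom_le_def using \<open>1 \<le> r\<close> by (intro member_le_sum) auto
    then have NR: "N \<le> binom_le m r" using Nm by simp
    have "x0 \<le> real N" unfolding N_def by linarith
    then have "x0 \<le> binom_le m r" using NR by (meson of_nat_le_iff order_trans)
    have "real K \<le> (1 - \<epsilon>) * binom_le m r"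
      unfolding K_def using \<epsilon> by (intro of_nat_floor) simp
    then have "2 - failure_bound s (binom_le m r) \<le> recovery_prob m d K"
      using rm dr s NR Nm by (intro recovery_prob_ge_failure_bound) (auto simp: N_def s_def)
    then show "1 - \<delta> \<le> recovery_prob m d (nat \<lfloor>(1 - \<epsilon>) * real (binom_le m (m - d - 1))\<rfloor>)"
      using x0[OF \<open>x0 \<le> binom_le m r\<close>] unfolding K_def r_def by linarith
  qed
qed simp

end
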